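(* Consider the scalar Rayleigh-fading BPSK model with parameters $P,\Omega_H,\Omega_S,\sigma_1^2,\sigma_2^2>0$ described in the context, with average effective SNRs $\bar\gamma_c=2P\Omega_H/\sigma_1^2$ and $\bar\gamma_s=2P\Omega_S/\sigma_2^2$, and let $C_0(D)=R(G^{-1}(D))$, $D\in[D_{\min},D_{\max}]=[G(1/2),G(1)]$, be its single-mode boundary. Then: 1. if $\bar\gamma_c>\bar\gamma_s$, then $C_0$ is strictly concave on the interior interval $(D_{\min},D_{\max})$, and time sharing is unnecessary; 2. if $\bar\gamma_c<\bar\gamma_s$, then $C_0$ is strictly convex on $(D_{\min},D_{\max})$, and time sharing gives a strict gain; 3. if $\bar\gamma_c=\bar\gamma_s$, then $C_0$ is linear (an affine function of $D$).
   Context: Model. $X=\sqrt P\,B$ with $B\in\{+1,-1\}$, $\Pr(B=+1)=p$, $p\in[1/2,1]$. The observations are $Y=HX+N_1$ and $V=SX+N_2$, where $H\sim\mathcal{CN}(0,\Omega_H)$, $S\sim\mathcal{CN}(0,\Omega_S)$, $N_1\sim\mathcal{CN}(0,\sigma_1^2)$, $N_2\sim\mathcal{CN}(0,\sigma_2^2)$ are circularly symmetric complex Gaussian, with the input, the fading/state and the noise mutually independent in each channel. The communication receiver knows $H$; the sensing receiver does not know $X$. Logarithms are base 2. Define $R(p)=I(X;Y|H)$ and $G(p)=I(S;V)$ (not conditioned on $X$). With $J(p,\gamma)=I(B;\sqrt\gamma B+Z)$, $Z\sim\mathcal N(0,1)$ real and independent of $B$, $\Pr(B=+1)=p$, these are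 $$R(p)=\int_0^\infty J(p,\gamma)\tfrac1{\bar\gamma_c}e^{-\gamma/\bar\gamma_c}\,d\gamma,\qquad G(p)=\log_2\!\Big(1+\tfrac{P\Omega_S}{\sigma_2^2}\Big)-\int_0^\infty J(p,\gamma)\tfrac1{\bar\gamma_s}e^{-\gamma/\bar\gamma_s}\,d\gamma.$$ On $[1/2,1]$, $R$ is decreasing and $G$ is (strictly) increasing, so $G^{-1}:[G(1/2),G(1)]\to[1/2,1]$ is well defined. The boundary with time sharing is the upper concave envelope of $C_0$: the smallest concave function on $[D_{\min},D_{\max}]$ that is $\ge C_0$. "Time sharing is unnecessary" means this envelope equals $C_0$; "time sharing gives a strict gain" means the envelope is strictly larger than $C_0$ on $(D_{\min},D_{\max})$. *)

theory Defs
  imports "HOL-Probability.Probability"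
begin

section \<open>The BPSK channel with Rayleigh fading\<close>

text \<open>The law \<open>CN(0, v)\<close>: real and imaginary parts are independent real Gaussians of
  variance \<open>v / 2\<close> each. The second parameter of \<^const>\<open>normal_density\<close> is the standard
  deviation.\<close>

definition complex_gaussian :: "real \<Rightarrow> complex measure" where
  "complex_gaussian v =
    distr (density lborel (normal_density 0 (sqrt (v / 2))) \<Otimes>\<^sub>M
           density lborel (normal_density 0 (sqrt (v / 2))))
      borel (\<lambda>(x, y). Complex x y)"

definition bpsk_input :: "real \<Rightarrow> bool \<Rightarrow> complex" where
  "bpsk_input P b = complex_of_real (sqrt P * (if b then 1 else -1))"

text \<open>Both channels have the form \<open>A X + N\<close> with \<open>A\<close> distributed as \<open>CN(0, \<Omega>)\<close> and \<open>N\<close> as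
  \<open>CN(0, \<sigma>\<^sup>2)\<close>. A sample point is a triple \<open>(b, a, n)\<close>, where \<open>b\<close> encodes the sign of the
  input; the product measure makes input, coefficient and noise mutually independent.\<close>

definition channel_space :: "real \<Rightarrow> real \<Rightarrow> real \<Rightarrow> (bool \<times> complex \<times> complex) measure" where
  "channel_space \<Omega> \<sigma> p =
    measure_pmf (bernoulli_pmf p) \<Otimes>\<^sub>M (complex_gaussian \<Omega> \<Otimes>\<^sub>M complex_gaussian (\<sigma>\<^sup>2))"

definition channel_input :: "real \<Rightarrow> bool \<times> complex \<times> complex \<Rightarrow> complex" where
  "channel_input P = (\<lambda>(b, a, n). bpsk_input P b)"

definition channel_coeff :: "bool \<times> complex \<times> complex \<Rightarrow> complex" where
  "channel_coeff = (\<lambda>(b, a, n). a)"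

definition channel_output :: "real \<Rightarrow> bool \<times> complex \<times> complex \<Rightarrow> complex" where
  "channel_output P = (\<lambda>(b, a, n). a * bpsk_input P b + n)"

lemma complex_measurable [measurable]: "(\<lambda>(x, y). Complex x y) \<in> borel \<Otimes>\<^sub>M borel \<rightarrow>\<^sub>M borel"
  unfolding Complex_eq by measurable

lemma prob_space_complex_gaussian: "v > 0 \<Longrightarrow> prob_space (complex_gaussian v)"
proof -
  assume "v > 0"
  then have "prob_space (density lborel (normal_density 0 (sqrt (v / 2))))"
    by (intro prob_space_normal_density) simp
  then show ?thesis
    unfolding complex_gaussian_def
    by (intro prob_space.prob_space_distr prob_space_pair) measurable
qed

lemma prob_space_channel_space:
  assumes "\<Omega> > 0" "\<sigma> > 0"
  shows "prob_space (channel_space \<Omega> \<sigma> p)"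
  unfolding channel_space_def using assms
  by (intro prob_space_pair prob_space_measure_pmf prob_space_complex_gaussian) simp_all

lemma sets_channel_space [measurable_cong]:
  "sets (channel_space \<Omega> \<sigma> p) = sets (count_space UNIV \<Otimes>\<^sub>M (borel \<Otimes>\<^sub>M borel))"
  unfolding channel_space_def complex_gaussian_def by (intro sets_pair_measure_cong) simp_all

lemma measurable_channel [measurable]:
  "channel_input P \<in> channel_space \<Omega> \<sigma> p \<rightarrow>\<^sub>M borel"
  "channel_coeff \<in> channel_space \<Omega> \<sigma> p \<rightarrow>\<^sub>M borel"
  "channel_output P \<in> channel_space \<Omega> \<sigma> p \<rightarrow>\<^sub>M borel"
  unfolding channel_input_def channel_coeff_def channel_output_def bpsk_input_def by measurable


section \<open>Rates and the single-mode boundary\<close>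

text \<open>\<open>I(X; Y | H)\<close> in bits\<close>

definition comm_rate :: "real \<Rightarrow> real \<Rightarrow> real \<Rightarrow> real \<Rightarrow> real" where
  "comm_rate P \<Omega> \<sigma> p =
    prob_space.conditional_mutual_information (channel_space \<Omega> \<sigma> p) 2 borel borel borel
      (channel_input P) (channel_output P) channel_coeff"

text \<open>\<open>I(S; V)\<close> in bits\<close>

definition sensing_rate :: "real \<Rightarrow> real \<Rightarrow> real \<Rightarrow> real \<Rightarrow> real" where
  "sensing_rate P \<Omega> \<sigma> p =
    prob_space.mutual_information (channel_space \<Omega> \<sigma> p) 2 borel borel
      channel_coeff (channel_output P)"

definition single_mode_boundary :: "(real \<Rightarrow> real) \<Rightarrow> (real \<Rightarrow> real) \<Rightarrow> real \<Rightarrow> real" where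
  "single_mode_boundary R G D = R (the_inv_into {1/2..1} G D)"


section \<open>Strict convexity and concave envelopes\<close>

definition strictly_convex_on :: "'a::real_vector set \<Rightarrow> ('a \<Rightarrow> real) \<Rightarrow> bool" where
  "strictly_convex_on S f \<longleftrightarrow> convex S \<and>
    (\<forall>x\<in>S. \<forall>y\<in>S. x \<noteq> y \<longrightarrow>
      (\<forall>u>0. \<forall>v>0. u + v = 1 \<longrightarrow> f (u *\<^sub>R x + v *\<^sub>R y) < u * f x + v * f y))"

definition strictly_concave_on :: "'a::real_vector set \<Rightarrow> ('a \<Rightarrow> real) \<Rightarrow> bool" where
  "strictly_concave_on S f \<longleftrightarrow> strictly_convex_on S (\<lambda>x. - f x)"

text \<open>\<open>E\<close> is the least concave majorant of \<open>f\<close> on \<open>S\<close>. Only the values of \<open>E\<close> on \<open>S\<close> matter,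
  and there they are unique; hence the existential quantifiers below.\<close>

definition is_upper_concave_envelope ::
    "'a::real_vector set \<Rightarrow> ('a \<Rightarrow> real) \<Rightarrow> ('a \<Rightarrow> real) \<Rightarrow> bool" where
  "is_upper_concave_envelope S f E \<longleftrightarrow>
    concave_on S E \<and> (\<forall>x\<in>S. f x \<le> E x) \<and>
    (\<forall>g. concave_on S g \<and> (\<forall>x\<in>S. f x \<le> g x) \<longrightarrow> (\<forall>x\<in>S. E x \<le> g x))"

lemma is_upper_concave_envelope_unique:
  assumes "is_upper_concave_envelope S f E" "is_upper_concave_envelope S f E'" "x \<in> S"
  shows "E x = E' x"
  using assms unfolding is_upper_concave_envelope_def by (meson order_antisym)

definition time_sharing_unnecessary :: "real \<Rightarrow> real \<Rightarrow> (real \<Rightarrow> real) \<Rightarrow> bool" where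
  "time_sharing_unnecessary a b C \<longleftrightarrow>
    (\<exists>E. is_upper_concave_envelope {a..b} C E \<and> (\<forall>D\<in>{a..b}. E D = C D))"

definition time_sharing_strict_gain :: "real \<Rightarrow> real \<Rightarrow> (real \<Rightarrow> real) \<Rightarrow> bool" where
  "time_sharing_strict_gain a b C \<longleftrightarrow>
    (\<exists>E. is_upper_concave_envelope {a..b} C E \<and> (\<forall>D\<in>{a<..<b}. C D < E D))"

end

theory Submission
  imports Defs
begin

text \<open>
  Given the fading coefficient, the half log-likelihood ratio \<open>T\<close> of the BPSK symbol is a quadratic form
  in independent complex Gaussians. A rotation diagonalises it with one positive and one negative
  eigenvalue, so \<open>T\<close> is a difference of independent exponential variables: it has density
  proportional to \<open>exp (t - s\<bar>t\<bar>)\<close>, where \<open>s = sqrt (1 + 2 / \<gamma>)\<close>. Folding onto \<open>t > 0\<close> writes \<open>R\<close>, and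
  a constant minus \<open>G\<close>, as the Laplace-type transform \<open>F s p = c s * \<integral> exp (- s t) \<kappa> p t dt\<close> of one kernel \<open>\<kappa>\<close>,
  with \<open>s\<close> given by \<open>\<gamma>\<^sub>c\<close> and \<open>\<gamma>\<^sub>s\<close> respectively. The derivative of \<open>\<kappa>\<close> in \<open>p\<close> is
  \<open>- 2 sinh t ln (A / B)\<close>, \<open>A = p e\<^sup>t + (1 - p) e\<^sup>-\<^sup>t\<close>, \<open>B = (1 - p) e\<^sup>t + p e\<^sup>-\<^sup>t\<close>, and for \<open>t < t'\<close> the ratio of these
  derivatives at \<open>t'\<close> and \<open>t\<close> increases in \<open>p\<close>. Cauchy's mean value theorem turns this into total
  positivity of the increments of \<open>\<kappa>\<close>, which integration against \<open>exp (- s t)\<close> preserves; hence the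
  boundary \<open>(G p, R p)\<close> bends in the direction determined by the sign of \<open>\<gamma>\<^sub>c - \<gamma>\<^sub>s\<close>.
\<close>

section \<open>The information kernel and its Laplace-type transform\<close>

text \<open>A larger \<gamma> means a smaller \<open>s\<close>, so \<open>exp (- s * t)\<close>
  moves weight to large \<open>t\<close>, where a larger share of the kernel's decrease in
  \<open>p\<close> happens late, near \<open>p = 1\<close>. If
  \<open>\<gamma>\<^sub>c > \<gamma>\<^sub>s\<close>, then \<open>R\<close> loses relatively more
  towards \<open>p = 1\<close> than \<open>G\<close> gains there, and the boundary bends down. The
  late share comes from A B = 1 + p (1 - p) (2 sinh t)^2: the derivative of ln (A / B) in
  \<open>p\<close> has this denominator, which falls as \<open>p\<close> grows from 1/2, and
  relatively faster for larger \<open>t\<close>. The mean value argument is therefore used twice,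
  from this derivative to ln (A / B), then from ln (A / B) to the kernel. All comparisons are
  cross-multiplied increments over p < q < r. At \<open>p = 1/2\<close> the derivative of the kernel
  vanishes for every \<open>t\<close>, so a quotient of derivatives of \<open>R\<close> and
  \<open>G\<close> would be 0 / 0 there; increments also spare differentiation under the integral
  and of the inverse of \<open>G\<close>. The function J never appears: fading and noise are
  averaged together in the law of \<open>T\<close>, and this makes the kernel elementary.\<close>

text \<open>Cauchy's mean value theorem on [x, y] and on [y, z] gives points c < y < d, at which
  \<open>mono\<close> compares the quotients f' / g'. Positivity of \<open>g'\<close> is asked only
  in the interior because the intended \<open>g'\<close> vanishes at 1/2.\<close>

lemma relative_slope_strict_mono:
  fixes f g f' g' :: "real \<Rightarrow> real"
  assumes "x < y" "y < z"
    and f: "\<And>p. x \<le> p \<Longrightarrow> p \<le> z \<Longrightarrow> (f has_real_derivative f' p) (at p)"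
    and g: "\<And>p. x \<le> p \<Longrightarrow> p \<le> z \<Longrightarrow> (g has_real_derivative g' p) (at p)"
    and pos: "\<And>p. x < p \<Longrightarrow> p < z \<Longrightarrow> 0 < g' p"
    and mono: "\<And>p q. x < p \<Longrightarrow> p < q \<Longrightarrow> q < z \<Longrightarrow> f' p * g' q < f' q * g' p"
  shows "(f y - f x) * (g z - g y) < (f z - f y) * (g y - g x)"
proof -
  have "\<exists>c. u < c \<and> c < v \<and> (f v - f u) * g' c = (g v - g u) * f' c \<and> 0 < g v - g u"
    if uv: "x \<le> u" "u < v" "v \<le> z" for u v
  proof -
    have "\<exists>c. u < c \<and> c < v \<and> (f v - f u) * g' c = (g v - g u) * f' c"
      by (rule GMVT') (use uv f g f[THEN DERIV_isCont] g[THEN DERIV_isCont] in auto)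
    moreover have "g u < g v"
    proof (rule DERIV_pos_imp_increasing_open[of u v g])
      show "\<exists>y. DERIV g p :> y \<and> 0 < y" if "u < p" "p < v" for p
        using that uv g[of p] pos[of p] by auto
      show "continuous_on {u..v} g"
        using uv g by (intro DERIV_continuous_on[where D=g']) (auto intro: has_field_derivative_at_within)
    qed (use uv in auto)
    ultimately show ?thesis by auto
  qed
  from this[of x y] this[of y z] assms(1,2) obtain c d where
    c: "x < c" "c < y" "(f y - f x) * g' c = (g y - g x) * f' c" "0 < g y - g x" and
    d: "y < d" "d < z" "(f z - f y) * g' d = (g z - g y) * f' d" "0 < g z - g y"
    by force
  have pc: "0 < g' c" "0 < g' d" using c d pos assms(1,2) by auto
  have "f' c * g' d < f' d * g' c" using mono c d by auto
  then have "(g y - g x) * (g z - g y) * (f' c * g' d) < (g y - g x) * (g z - g y) * (f' d * g' c)"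
    using c d by simp
  then have "((f y - f x) * (g z - g y)) * (g' c * g' d) < ((f z - f y) * (g y - g x)) * (g' c * g' d)"
    using c(3) d(3) by (metis (no_types, opaque_lifting) mult.assoc mult.left_commute mult.commute)
  then show ?thesis using pc by simp
qed

section \<open>Monotonicity of the information kernel in the prior\<close>

text \<open>\<open>tilt p t\<close> and \<open>tilt (1 - p) t\<close> are the A and B of the
  overview: up to a common factor, the probability weights of T = t and T = - t when the symbol +1
  has prior \<open>p\<close>.\<close>

definition tilt :: "real \<Rightarrow> real \<Rightarrow> real" where
  "tilt p t = p * exp t + (1 - p) * exp (- t)"

lemma tilt_bounds:
  assumes "p \<in> {0..1}" "0 \<le> t"
  shows "exp (- t) \<le> tilt p t" "tilt p t \<le> exp t"
proof -
  have "exp (- t) \<le> exp t" using assms by simp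
  moreover have "tilt p t = exp (-t) + p * (exp t - exp (-t))" "tilt p t = exp t - (1-p) * (exp t - exp (-t))"
    by (simp_all add: tilt_def algebra_simps)
  moreover from calculation(1) have "0 \<le> p * (exp t - exp (-t))" "0 \<le> (1-p) * (exp t - exp (-t))"
    using assms by auto
  ultimately show "exp (- t) \<le> tilt p t" "tilt p t \<le> exp t"
    by linarith+
qed

lemma tilt_pos: "p \<in> {0..1} \<Longrightarrow> 0 < tilt p t"
  unfolding tilt_def
  by (cases "p = 0") (auto intro!: add_pos_nonneg)

lemma abs_ln_tilt_le:
  assumes "p \<in> {0..1}" "0 \<le> t"
  shows "\<bar>ln (tilt p t)\<bar> \<le> t"
proof -
  have "ln (exp (-t)) \<le> ln (tilt p t)" "ln (tilt p t) \<le> ln (exp t)"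
    using tilt_bounds[OF assms] tilt_pos[OF assms(1), of t] by (subst ln_le_cancel_iff; simp)+
  then show ?thesis by simp
qed

lemma tilt_add: "tilt p t + tilt (1 - p) t = exp t + exp (- t)"
  by (simp add: tilt_def algebra_simps)

text \<open>The prior enters only through \<open>p * (1 - p)\<close>, which decreases on [1/2, 1];
  every monotonicity in \<open>p\<close> below goes back to this.\<close>

lemma tilt_mult: "tilt p t * tilt (1 - p) t = 1 + p * (1 - p) * (exp t - exp (- t))\<^sup>2"
  by (simp add: tilt_def exp_minus field_simps power2_eq_square)

definition tilt_ratio :: "real \<Rightarrow> real \<Rightarrow> real" where
  "tilt_ratio p t = ln (tilt p t) - ln (tilt (1 - p) t)"

text \<open>Given \<bar>T\<bar> = t, only the sign of T is left: a binary symmetric channel with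
  correct and wrong weights \<open>exp t\<close> and \<open>exp (- t)\<close>. The kernel is its
  mutual information in nats for prior \<open>p\<close>, multiplied by the total weight
  \<open>exp t + exp (- t)\<close>.\<close>

definition info_kernel :: "real \<Rightarrow> real \<Rightarrow> real" where
  "info_kernel p t = t * (exp t - exp (- t))
     - tilt p t * ln (tilt p t) - tilt (1 - p) t * ln (tilt (1 - p) t)"

lemma has_derivative_tilt:
  "((\<lambda>p. tilt p t) has_real_derivative (exp t - exp (- t))) (at p)"
  "((\<lambda>p. tilt (1 - p) t) has_real_derivative - (exp t - exp (- t))) (at p)"
  unfolding tilt_def by (auto intro!: derivative_eq_intros)

lemma has_derivative_tilt_ratio:
  assumes "p \<in> {0..1}"
  shows "((\<lambda>p. tilt_ratio p t) has_real_derivative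
    (exp t - exp (- t)) * (exp t + exp (- t)) / (1 + p * (1 - p) * (exp t - exp (- t))\<^sup>2)) (at p)"
proof -
  have pos: "0 < tilt p t" "0 < tilt (1 - p) t" using tilt_pos assms by auto
  have "((\<lambda>p. tilt_ratio p t) has_real_derivative
    (exp t - exp (- t)) * (1 / tilt p t + 1 / tilt (1 - p) t)) (at p)"
    unfolding tilt_ratio_def using pos
    by (auto intro!: derivative_eq_intros has_derivative_tilt simp: field_simps)
  moreover have "1 / tilt p t + 1 / tilt (1 - p) t = (exp t + exp (-t)) / (tilt p t * tilt (1 - p) t)"
    using pos tilt_add[of p t] by (simp add: field_simps)
  ultimately show ?thesis by (simp add: tilt_mult)
qed

text \<open>The constants from differentiating x ln x cancel, since the two tilts have a sum
  independent of \<open>p\<close>.\<close>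

lemma has_derivative_info_kernel:
  assumes "p \<in> {0..1}"
  shows "((\<lambda>p. info_kernel p t) has_real_derivative - (exp t - exp (- t)) * tilt_ratio p t) (at p)"
proof -
  have pos: "0 < tilt p t" "0 < tilt (1 - p) t" using tilt_pos assms by auto
  show ?thesis
    unfolding info_kernel_def tilt_ratio_def using pos
    by (auto intro!: derivative_eq_intros has_derivative_tilt simp: field_simps)
qed

lemma tilt_ratio_half [simp]: "tilt_ratio (1/2) t = 0"
  by (simp add: tilt_ratio_def)

lemma tilt_ratio_pos:
  assumes "1/2 < p" "p \<le> 1" "0 < t"
  shows "0 < tilt_ratio p t"
proof -
  have "tilt p t - tilt (1 - p) t = (2 * p - 1) * (exp t - exp (- t))"
    by (simp add: tilt_def algebra_simps)
  moreover have "\<dots> > 0" using assms by simp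
  ultimately have "tilt (1 - p) t < tilt p t" by linarith
  then show ?thesis
    using tilt_pos[of p t] tilt_pos[of "1-p" t] assms by (simp add: tilt_ratio_def)
qed

text \<open>\<open>tilt_ratio\<close> vanishes at 1/2, so its value is an increment from 1/2 and the
  slope comparison applies with x = 1/2.\<close>

lemma tilt_ratio_relative_mono:
  assumes "1/2 < p" "p < q" "q \<le> 1" "0 < t" "t < t'"
  shows "tilt_ratio p t' * tilt_ratio q t < tilt_ratio q t' * tilt_ratio p t"
proof -
  define e where "e t = exp t - exp (- t :: real)" for t
  define h where "h t = exp t + exp (- t :: real)" for t
  define D where "D t u = e t * h t / (1 + u * (1 - u) * (e t)\<^sup>2)" for t u
  have e: "0 < e t" "e t < e t'" using assms by (auto simp: e_def intro: diff_strict_mono)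
  have h: "0 < h t" for t by (simp add: h_def add_pos_pos)
  have dpos: "0 < 1 + u * (1 - u) * (e r)\<^sup>2" if "0 \<le> u" "u \<le> 1" for u r
    using that by (intro add_pos_nonneg) auto
  have "(tilt_ratio p t' - tilt_ratio (1/2) t') * (tilt_ratio q t - tilt_ratio p t)
    < (tilt_ratio q t' - tilt_ratio p t') * (tilt_ratio p t - tilt_ratio (1/2) t)"
  proof (rule relative_slope_strict_mono[where f'="D t'" and g'="D t"])
    show "((\<lambda>p. tilt_ratio p t') has_real_derivative D t' u) (at u)"
      "((\<lambda>p. tilt_ratio p t) has_real_derivative D t u) (at u)" if "1/2 \<le> u" "u \<le> q" for u
      using has_derivative_tilt_ratio[of u] that assms by (auto simp: D_def e_def h_def)
    show "0 < D t u" if "1/2 < u" "u < q" for u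
      using dpos[of u t] that assms e h[of t] by (auto simp: D_def)
    show "D t' u * D t v < D t' v * D t u" if uv: "1/2 < u" "u < v" "v < q" for u v
    proof -
      have "0 < (v - u) * (u + v - 1)" using uv by auto
      also have "\<dots> = u * (1 - u) - v * (1 - v)" by (simp add: algebra_simps)
      finally have w: "v * (1 - v) < u * (1 - u)" by simp
      have "(e t)\<^sup>2 < (e t')\<^sup>2" using e by (auto intro: power_strict_mono)
      \<comment> \<open>This product is exactly the difference of the two sides of the next
        inequality; the constant and the fourth-order terms cancel.\<close>
      then have "0 < (u * (1 - u) - v * (1 - v)) * ((e t')\<^sup>2 - (e t)\<^sup>2)" using w by auto
      then have "(1 + u * (1 - u) * (e t)\<^sup>2) * (1 + v * (1 - v) * (e t')\<^sup>2)
        < (1 + u * (1 - u) * (e t')\<^sup>2) * (1 + v * (1 - v) * (e t)\<^sup>2)"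
        by (simp add: algebra_simps)
      then have "1 / ((1 + u * (1 - u) * (e t')\<^sup>2) * (1 + v * (1 - v) * (e t)\<^sup>2))
         < 1 / ((1 + v * (1 - v) * (e t')\<^sup>2) * (1 + u * (1 - u) * (e t)\<^sup>2))"
        using dpos[of u] dpos[of v] uv assms
        by (intro divide_strict_left_mono mult_pos_pos) (auto simp: mult.commute)
      then have "e t * h t * (e t' * h t') * (1 / ((1 + u * (1 - u) * (e t')\<^sup>2) * (1 + v * (1 - v) * (e t)\<^sup>2)))
         < e t * h t * (e t' * h t') * (1 / ((1 + v * (1 - v) * (e t')\<^sup>2) * (1 + u * (1 - u) * (e t)\<^sup>2)))"
        using e h by (intro mult_strict_left_mono) auto
      then show ?thesis by (simp add: D_def mult_ac)
    qed
  qed (use assms in auto)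
  then show ?thesis by (simp add: algebra_simps)
qed

lemma info_kernel_strict_antimono:
  assumes "1/2 \<le> p" "p < q" "q \<le> 1" "0 < t"
  shows "info_kernel q t < info_kernel p t"
proof (rule DERIV_neg_imp_decreasing_open[of p q "\<lambda>p. info_kernel p t"])
  show "continuous_on {p..q} (\<lambda>p. info_kernel p t)"
    using assms
    by (intro DERIV_continuous_on[OF has_field_derivative_at_within[OF has_derivative_info_kernel]]) auto
  show "\<exists>y. ((\<lambda>p. info_kernel p t) has_real_derivative y) (at u) \<and> y < 0" if "p < u" "u < q" for u
    using that assms
    by (intro exI[of _ "- (exp t - exp (- t)) * tilt_ratio u t"] conjI has_derivative_info_kernel)
      (auto intro!: mult_neg_pos tilt_ratio_pos)
qed fact

text \<open>The slope comparison is applied a second time, now with \<open>tilt_ratio\<close> in the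
  derivative; the factor \<open>exp t - exp (- t)\<close> does not depend on \<open>p\<close> and
  scales both sides alike. The kernel is negated because it decreases in \<open>p\<close>.\<close>

lemma info_kernel_relative_mono:
  assumes "1/2 \<le> p" "p < q" "q < r" "r \<le> 1" "0 < t" "t < t'"
  shows "(info_kernel p t' - info_kernel q t') * (info_kernel q t - info_kernel r t)
    < (info_kernel q t' - info_kernel r t') * (info_kernel p t - info_kernel q t)"
proof -
  define D where "D t u = (exp t - exp (- t)) * tilt_ratio u t" for t u
  have "(- info_kernel q t' - - info_kernel p t') * (- info_kernel r t - - info_kernel q t)
    < (- info_kernel r t' - - info_kernel q t') * (- info_kernel q t - - info_kernel p t)"
  proof (rule relative_slope_strict_mono[where f'="D t'" and g'="D t"])
    show "((\<lambda>p. - info_kernel p t') has_real_derivative D t' u) (at u)"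
      "((\<lambda>p. - info_kernel p t) has_real_derivative D t u) (at u)" if "p \<le> u" "u \<le> r" for u
      using DERIV_minus[OF has_derivative_info_kernel[of u t']] DERIV_minus[OF has_derivative_info_kernel[of u t]]
        that assms by (auto simp: D_def algebra_simps)
    show "0 < D t u" if "p < u" "u < r" for u
      using that assms by (auto simp: D_def intro!: mult_pos_pos tilt_ratio_pos)
    show "D t' u * D t v < D t' v * D t u" if uv: "p < u" "u < v" "v < r" for u v
    proof -
      have "0 < (exp t - exp (- t)) * (exp t' - exp (- t'))" using assms by auto
      from mult_strict_left_mono[OF tilt_ratio_relative_mono this, of u v t t'] show ?thesis
        using uv assms by (simp add: D_def mult_ac)
    qed
  qed (use assms in auto)
  then show ?thesis by (simp add: algebra_simps)
qed

lemma info_kernel_bound: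
  assumes "p \<in> {0..1}" "0 \<le> t"
  shows "\<bar>info_kernel p t\<bar> \<le> 4 * (t * exp t)"
proof -
  have q: "1 - p \<in> {0..1}" using assms by auto
  have 1: "\<bar>tilt u t * ln (tilt u t)\<bar> \<le> exp t * t" if "u \<in> {0..1}" for u
    unfolding abs_mult using tilt_pos[OF that, of t] tilt_bounds[OF that assms(2)]
      abs_ln_tilt_le[OF that assms(2)] assms by (intro mult_mono) auto
  have 2: "\<bar>t * (exp t - exp (- t))\<bar> \<le> t * exp t"
    unfolding abs_mult using assms by (intro mult_mono) auto
  have "\<bar>info_kernel p t\<bar> \<le> t * exp t + exp t * t + exp t * t"
    unfolding info_kernel_def using 1[OF assms(1)] 1[OF q] 2 by linarith
  also have "\<dots> \<le> 4 * (t * exp t)" using assms by (simp add: mult.commute)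
  finally show ?thesis .
qed

lemma info_kernel_measurable [measurable]: "info_kernel p \<in> borel_measurable borel"
  unfolding info_kernel_def tilt_def by measurable

section \<open>Integration against exponentials and the single-crossing argument\<close>

lemma set_integral_pos:
  fixes f :: "'a \<Rightarrow> real"
  assumes f: "set_integrable M A f" "AE t in M. t \<in> A \<longrightarrow> 0 < f t"
    and A: "A \<in> sets M" "emeasure M A \<noteq> 0"
  shows "0 < (LINT t:A|M. f t)"
proof -
  have nn: "AE t in M. 0 \<le> indicator A t *\<^sub>R f t"
    using f(2) by eventually_elim (auto simp: indicator_def)
  have "(LINT t:A|M. f t) \<noteq> 0"
  proof
    assume "(LINT t:A|M. f t) = 0"
    then have "AE t in M. indicator A t *\<^sub>R f t = 0"
      using integral_nonneg_eq_0_iff_AE[OF f(1)[unfolded set_integrable_def] nn]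
      by (simp add: set_lebesgue_integral_def)
    with f(2) have "AE t in M. t \<notin> A"
      by eventually_elim (auto simp: indicator_def)
    with A show False
      using AE_iff_null_sets[OF A(1)] by auto
  qed
  moreover have "0 \<le> (LINT t:A|M. f t)"
    unfolding set_lebesgue_integral_def by (rule integral_nonneg_AE[OF nn])
  ultimately show ?thesis by simp
qed

lemma emeasure_lborel_greaterThan_0: "emeasure lborel {0::real<..} \<noteq> 0"
proof -
  have "{0::real<..1} \<subseteq> {0<..}" by auto
  then have "emeasure lborel {0::real<..1} \<le> emeasure lborel {0::real<..}"
    by (intro emeasure_mono) auto
  then show ?thesis by auto
qed

text \<open>Since b / a increases, b - l a changes sign once, from minus to plus. Passing from
  \<open>s2\<close> to \<open>s1\<close> multiplies the weight by the increasing factor exp ((s2 -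
  s1) t), so an integral balanced to zero at \<open>s2\<close> becomes positive at
  \<open>s1\<close>.\<close>

lemma single_crossing_integral:
  fixes a b :: "real \<Rightarrow> real"
  assumes s: "s1 < s2"
    and a_pos: "\<And>t. 0 < t \<Longrightarrow> 0 < a t"
    and mono: "\<And>t t'. 0 < t \<Longrightarrow> t < t' \<Longrightarrow> a t' * b t < b t' * a t"
    and int: "\<And>s. s \<in> {s1, s2} \<Longrightarrow> set_integrable lborel {0<..} (\<lambda>t. exp (- s * t) * a t)"
      "\<And>s. s \<in> {s1, s2} \<Longrightarrow> set_integrable lborel {0<..} (\<lambda>t. exp (- s * t) * b t)"
  defines "I f s \<equiv> (LINT t:{0<..}|lborel. exp (- s * t) * f t)"
  shows "I a s1 * I b s2 < I b s1 * I a s2"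
proof -
  note [simp] = emeasure_lborel_greaterThan_0
  have Ia: "0 < I a s" if "s \<in> {s1, s2}" for s
    unfolding I_def using int(1)[OF that] a_pos by (intro set_integral_pos) auto
  \<comment> \<open>The multiple of \<open>a\<close> that balances \<open>b\<close> under the weight
    with \<open>s2\<close>.\<close>
  define l where "l = I b s2 / I a s2"
  have lin: "set_integrable lborel {0<..} (\<lambda>t. exp (- s * t) * (b t - l * a t))"
    "(LINT t:{0<..}|lborel. exp (- s * t) * (b t - l * a t)) = I b s - l * I a s" if "s \<in> {s1,s2}" for s
  proof -
    have eq: "exp (- s * t) * (b t - l * a t) = exp (- s * t) * b t - l * (exp (- s * t) * a t)" for t
      by (simp add: algebra_simps)
    show "set_integrable lborel {0<..} (\<lambda>t. exp (- s * t) * (b t - l * a t))"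
      unfolding eq using int[OF that] by (intro set_integral_diff set_integrable_mult_right) auto
    show "(LINT t:{0<..}|lborel. exp (- s * t) * (b t - l * a t)) = I b s - l * I a s"
      unfolding eq I_def using int[OF that] by (subst set_integral_diff) auto
  qed
  have zero: "(LINT t:{0<..}|lborel. exp (- s2 * t) * (b t - l * a t)) = 0"
    using lin(2)[of s2] Ia[of s2] by (simp add: l_def)
  \<comment> \<open>By \<open>down\<close> this is an initial segment of the half-line. Without
    continuity of \<open>a\<close> and \<open>b\<close> the crossing point is obtained as its
    supremum; a zero integral at \<open>s2\<close> excludes that the sign is constant, so
    \<open>N\<close> is nonempty and bounded.\<close>
  define N where "N = {t. 0 < t \<and> b t \<le> l * a t}"
  have down: "b t < l * a t" if "t' \<in> N" "0 < t" "t < t'" for t t'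
  proof -
    have "a t' * b t < b t' * a t" using mono that by auto
    also have "\<dots> \<le> l * a t' * a t" using that a_pos[of t] by (auto simp: N_def intro!: mult_right_mono)
    finally have "a t' * b t < a t' * (l * a t)" by (simp add: mult_ac)
    then show ?thesis using a_pos[of t'] that by (auto simp: N_def)
  qed
  have "N \<noteq> {}"
  proof
    assume "N = {}"
    then have "0 < b t - l * a t" if "0 < t" for t using that by (force simp: N_def)
    then have "0 < (LINT t:{0<..}|lborel. exp (- s2 * t) * (b t - l * a t))"
      using lin(1)[of s2] by (intro set_integral_pos) auto
    with zero show False by simp
  qed
  moreover have "bdd_above N"
  proof (rule ccontr)
    assume nb: "\<not> bdd_above N"
    have "0 < l * a t - b t" if "0 < t" for t
    proof -
      from nb obtain t' where "t' \<in> N" "t < t'"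
        unfolding bdd_above_def by (meson not_le)
      with down that show ?thesis by fastforce
    qed
    then have "0 < (LINT t:{0<..}|lborel. - (exp (- s2 * t) * (b t - l * a t)))"
    proof (intro set_integral_pos)
      show "set_integrable lborel {0<..} (\<lambda>t. - (exp (- s2 * t) * (b t - l * a t)))"
        using set_integrable_mult_right[OF lin(1)[of s2], of "-1"] by simp
    qed (auto intro!: mult_pos_neg)
    with zero show False by (simp add: set_lebesgue_integral_def)
  qed
  ultimately have sup: "t < Sup N \<Longrightarrow> \<exists>t'\<in>N. t < t'" "t \<in> N \<Longrightarrow> t \<le> Sup N" for t
    using less_cSup_iff[of N t] cSup_upper[of t N] by auto
  define T where "T = Sup N"
  define d where "d = s2 - s1"
  have d: "0 < d" using s by (simp add: d_def)
  \<comment> \<open>Subtracting the constant exp (d T) makes the weight change sign at the same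
    point as b - l a; the subtracted part integrates to zero by the choice of
    \<open>l\<close>.\<close>
  have sp: "0 < (exp (d * t) - exp (d * T)) * (b t - l * a t)" if "0 < t" "t \<noteq> T" for t
  proof (cases "t < T")
    case True
    then obtain t' where "t' \<in> N" "t < t'" using sup by (auto simp: T_def)
    then have "b t < l * a t" using down that by auto
    then show ?thesis using True d by (intro mult_neg_neg) auto
  next
    case False
    then have "t \<notin> N" "T < t" using sup[of t] that by (auto simp: T_def)
    then show ?thesis using that d by (intro mult_pos_pos) (auto simp: N_def)
  qed
  have ex: "exp (- s1 * t) = exp (d * t) * exp (- s2 * t)" for t
    by (simp add: d_def flip: exp_add) (simp add: algebra_simps)
  have eq: "exp (- s1 * t) * (b t - l * a t) - exp (d * T) * (exp (- s2 * t) * (b t - l * a t))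
      = exp (- s2 * t) * ((exp (d * t) - exp (d * T)) * (b t - l * a t))" for t
    unfolding ex by (simp add: algebra_simps)
  have i1: "set_integrable lborel {0<..} (\<lambda>t. exp (- s1 * t) * (b t - l * a t) - exp (d * T) * (exp (- s2 * t) * (b t - l * a t)))"
    using lin(1)[of s1] lin(1)[of s2] by (intro set_integral_diff set_integrable_mult_right) auto
  have "0 < (LINT t:{0<..}|lborel. exp (- s1 * t) * (b t - l * a t) - exp (d * T) * (exp (- s2 * t) * (b t - l * a t)))"
  proof (rule set_integral_pos[OF i1])
    show "AE t in lborel. t \<in> {0<..} \<longrightarrow> 0 < exp (- s1 * t) * (b t - l * a t) - exp (d * T) * (exp (- s2 * t) * (b t - l * a t))"
      unfolding eq using AE_lborel_singleton[of T] by eventually_elim (auto intro!: mult_pos_pos sp)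
  qed auto
  also have "\<dots> = I b s1 - l * I a s1"
    using lin[of s1] lin[of s2] zero by (subst set_integral_diff) auto
  finally show ?thesis using Ia[of s2] by (simp add: l_def field_simps)
qed

text \<open>The factor is the reciprocal of the integral of exp (t - s \<bar>t\<bar>) over the line,
  1 / (s - 1) + 1 / (s + 1). The value is in nats; bits come from a later division by
  \<open>ln 2\<close>.\<close>

definition info_transform :: "real \<Rightarrow> real \<Rightarrow> real" where
  "info_transform s p = (s\<^sup>2 - 1) / (2 * s) * (LINT t:{0<..}|lborel. exp (- s * t) * info_kernel p t)"

lemma set_integrable_power_exp:
  assumes "0 < (a::real)"
  shows "set_integrable lborel {0<..} (\<lambda>t. t * exp (- a * t))"
proof -
  \<comment> \<open>\<open>erlang_density 0 a\<close> is the exponential density of rate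
    \<open>a\<close>, so the integral is a first moment divided by \<open>a\<close>.\<close>
  have "(\<integral>\<^sup>+ t. ennreal (indicator {0<..} t * (t * exp (- a * t))) \<partial>lborel)
    = (\<integral>\<^sup>+ t. ennreal (erlang_density 0 a t * t ^ 1 / a) \<partial>lborel)"
    using assms by (intro nn_integral_cong) (auto simp: erlang_density_def indicator_def)
  also have "\<dots> = (\<integral>\<^sup>+ t. ennreal (1 / a) * ennreal (erlang_density 0 a t * t ^ 1) \<partial>lborel)"
    using assms by (intro nn_integral_cong) (simp add: ennreal_mult'[symmetric])
  also have "\<dots> = ennreal (1 / a) * (\<integral>\<^sup>+ t. ennreal (erlang_density 0 a t * t ^ 1) \<partial>lborel)"
    by (rule nn_integral_cmult) auto
  also have "\<dots> < \<infinity>" using assms by (subst nn_integral_erlang_ith_moment) (auto simp: ennreal_mult_less_top)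
  finally show ?thesis
    unfolding set_integrable_def by (intro integrableI_nonneg) (auto simp: indicator_def)
qed

lemma info_kernel_exp_bound:
  assumes "p \<in> {0..1}" "0 < t"
  shows "\<bar>exp (- s * t) * info_kernel p t\<bar> \<le> 4 * (t * exp (- (s - 1) * t))"
proof -
  have "\<bar>exp (- s * t) * info_kernel p t\<bar> \<le> exp (- s * t) * (4 * (t * exp t))"
    unfolding abs_mult using info_kernel_bound[of p t] assms by (intro mult_mono) auto
  also have "\<dots> = 4 * (t * (exp (- s * t) * exp t))" by simp
  also have "exp (- s * t) * exp t = exp (- (s - 1) * t)"
    by (simp add: algebra_simps flip: exp_add)
  finally show ?thesis .
qed

lemma set_integrable_info_kernel:
  assumes "1 < s" "p \<in> {0..1}"
  shows "set_integrable lborel {0<..} (\<lambda>t. exp (- s * t) * info_kernel p t)"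
  unfolding set_integrable_def
proof (rule Bochner_Integration.integrable_bound)
  show "integrable lborel (\<lambda>t. indicator {0<..} t *\<^sub>R (4 * (t * exp (- (s - 1) * t))))"
    using set_integrable_mult_right[OF set_integrable_power_exp[of "s - 1"], of 4] assms
    by (simp add: set_integrable_def)
  show "AE x in lborel. norm (indicator {0<..} x *\<^sub>R (exp (- s * x) * info_kernel p x))
    \<le> norm (indicator {0<..} x *\<^sub>R (4 * (x * exp (- (s - 1) * x))))"
    using info_kernel_exp_bound[OF assms(2), of _ s] by (auto simp: indicator_def)
qed auto

text \<open>Dominated convergence with a bound that is free of \<open>p\<close>. Continuity serves
  to show that every D between the end values of \<open>G\<close> is attained.\<close>

lemma continuous_on_info_transform:
  assumes "1 < s"
  shows "continuous_on {0..1} (info_transform s)"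
proof -
  have "continuous_on {0..1} (\<lambda>p. LINT t:{0<..}|lborel. exp (- s * t) * info_kernel p t)"
    unfolding set_lebesgue_integral_def
  proof (rule continuous_on_sequentiallyI)
    fix u p assume u: "\<forall>n. u n \<in> {0..1::real}" "p \<in> {0..1}" "u \<longlonglongrightarrow> p"
    show "(\<lambda>n. LINT t|lborel. indicator {0<..} t *\<^sub>R (exp (- s * t) * info_kernel (u n) t))
      \<longlonglongrightarrow> (LINT t|lborel. indicator {0<..} t *\<^sub>R (exp (- s * t) * info_kernel p t))"
    proof (rule integral_dominated_convergence[where w="\<lambda>t. indicator {0<..} t *\<^sub>R (4 * (t * exp (- (s - 1) * t)))"])
      show "integrable lborel (\<lambda>t. indicator {0<..} t *\<^sub>R (4 * (t * exp (- (s - 1) * t))))"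
        using set_integrable_mult_right[OF set_integrable_power_exp[of "s - 1"], of 4] assms
        by (simp add: set_integrable_def)
      show "AE t in lborel. (\<lambda>n. indicator {0<..} t *\<^sub>R (exp (- s * t) * info_kernel (u n) t))
          \<longlonglongrightarrow> indicator {0<..} t *\<^sub>R (exp (- s * t) * info_kernel p t)"
        using isCont_tendsto_compose[OF DERIV_isCont[OF has_derivative_info_kernel[OF u(2)]] u(3)]
        by (intro always_eventually allI tendsto_intros) auto
      show "AE t in lborel. norm (indicator {0<..} t *\<^sub>R (exp (- s * t) * info_kernel (u n) t))
          \<le> indicator {0<..} t *\<^sub>R (4 * (t * exp (- (s - 1) * t)))" for n
        using info_kernel_exp_bound[of "u n" _ s] u by (auto simp: indicator_def)
    qed auto
  qed
  then show ?thesis unfolding info_transform_def by (intro continuous_intros)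
qed

lemma info_transform_diff:
  assumes "1 < s" "p \<in> {0..1}" "q \<in> {0..1}"
  shows "set_integrable lborel {0<..} (\<lambda>t. exp (- s * t) * (info_kernel p t - info_kernel q t))"
    "info_transform s p - info_transform s q
      = (s\<^sup>2 - 1) / (2 * s) * (LINT t:{0<..}|lborel. exp (- s * t) * (info_kernel p t - info_kernel q t))"
proof -
  note i = set_integrable_info_kernel[OF assms(1,2)] set_integrable_info_kernel[OF assms(1,3)]
  show "set_integrable lborel {0<..} (\<lambda>t. exp (- s * t) * (info_kernel p t - info_kernel q t))"
    using set_integral_diff(1)[OF i] by (simp add: algebra_simps)
  show "info_transform s p - info_transform s q
      = (s\<^sup>2 - 1) / (2 * s) * (LINT t:{0<..}|lborel. exp (- s * t) * (info_kernel p t - info_kernel q t))"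
    using set_integral_diff(2)[OF i] by (simp add: info_transform_def right_diff_distrib)
qed

text \<open>The single-crossing lemma with \<open>a\<close> the drop of the kernel from
  \<open>p\<close> to \<open>q\<close> and \<open>b\<close> the drop from \<open>q\<close> to
  \<open>r\<close>; its hypothesis \<open>mono\<close> is then
  \<open>info_kernel_relative_mono\<close>.\<close>

lemma info_transform_relative_mono:
  assumes s: "1 < s1" "s1 < s2" and p: "1/2 \<le> p" "p < q" "q < r" "r \<le> 1"
  shows "(info_transform s1 p - info_transform s1 q) * (info_transform s2 q - info_transform s2 r)
    < (info_transform s1 q - info_transform s1 r) * (info_transform s2 p - info_transform s2 q)"
proof -
  have c: "0 < (s1\<^sup>2 - 1) / (2 * s1)" "0 < (s2\<^sup>2 - 1) / (2 * s2)" using s by auto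
  have P: "p \<in> {0..1}" "q \<in> {0..1}" "r \<in> {0..1}" using p by auto
  define I where "I s p q = (LINT t:{0<..}|lborel. exp (- s * t) * (info_kernel p t - info_kernel q t))" for s p q
  have "I s1 p q * I s2 q r < I s1 q r * I s2 p q"
    unfolding I_def
  proof (rule single_crossing_integral[OF s(2)])
    show "0 < info_kernel p t - info_kernel q t" if "0 < t" for t
      using info_kernel_strict_antimono[of p q t] p that by auto
    show "(info_kernel p t' - info_kernel q t') * (info_kernel q t - info_kernel r t)
       < (info_kernel q t' - info_kernel r t') * (info_kernel p t - info_kernel q t)" if "0 < t" "t < t'" for t t'
      using info_kernel_relative_mono[OF p that] .
  qed (use s P info_transform_diff(1) in auto)
  from mult_strict_left_mono[OF this mult_pos_pos[OF c]] show ?thesis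
    using info_transform_diff(2)[of s1 p q] info_transform_diff(2)[of s1 q r]
      info_transform_diff(2)[of s2 p q] info_transform_diff(2)[of s2 q r] s P
    by (simp only: I_def mult_ac)
qed

lemma info_transform_strict_antimono:
  assumes s: "1 < s" and p: "1/2 \<le> p" "p < q" "q \<le> 1"
  shows "info_transform s q < info_transform s p"
proof -
  have c: "0 < (s\<^sup>2 - 1) / (2 * s)" using s by auto
  have "0 < info_transform s p - info_transform s q"
    using emeasure_lborel_greaterThan_0 info_transform_diff(1)[of s p q] info_kernel_strict_antimono[of p q] s p c
    by (subst info_transform_diff(2)) (auto simp del: times_divide_eq_left intro!: mult_pos_pos[OF c] set_integral_pos)
  then show ?thesis by simp
qed

section \<open>Slopes, convexity and envelopes\<close>

lemma strictly_convex_on_slopesI: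
  fixes f :: "real \<Rightarrow> real"
  assumes "convex S"
    and slopes: "\<And>x y z. x \<in> S \<Longrightarrow> z \<in> S \<Longrightarrow> x < y \<Longrightarrow> y < z \<Longrightarrow>
      (f y - f x) * (z - y) < (f z - f y) * (y - x)"
  shows "strictly_convex_on S f"
proof -
  have main: "f (u * x + v * y) < u * f x + v * f y"
    if "x \<in> S" "y \<in> S" "x < y" "0 < u" "0 < v" "u + v = 1" for x y u v
  proof -
    define m where "m = u * x + v * y"
    have u: "u = 1 - v" using that by simp
    \<comment> \<open>The distances from \<open>m\<close> to the end points are proportional to the
      opposite weights, so the slope inequality becomes the convexity inequality after division by y
      - x.\<close>
    have m: "m - x = v * (y - x)" "y - m = u * (y - x)" by (simp_all add: m_def u algebra_simps)
    have "0 < v * (y - x)" "0 < u * (y - x)" using that by auto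
    then have "x < m" "m < y" using m by auto
    from slopes[OF that(1,2) this] have "((f m - f x) * u) * (y - x) < ((f y - f m) * v) * (y - x)"
      by (simp add: m mult_ac)
    then have "(f m - f x) * u < (f y - f m) * v" using that by simp
    then have "f m < u * f x + v * f y" by (simp add: u algebra_simps)
    then show ?thesis by (simp add: m_def)
  qed
  have "f (u * x + v * y) < u * f x + v * f y"
    if "x \<in> S" "y \<in> S" "x \<noteq> y" "0 < u" "0 < v" "u + v = 1" for x y u v
    using main[of x y u v] main[of y x v u] that by (cases "x < y") (auto simp: add.commute)
  with assms(1) show ?thesis by (auto simp: strictly_convex_on_def)
qed

lemma strictly_convex_on_imp_convex_on:
  assumes "strictly_convex_on S f"
  shows "convex_on S f"
proof -
  have "f (u *\<^sub>R x + v *\<^sub>R y) \<le> u * f x + v * f y"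
    if "x \<in> S" "y \<in> S" "0 \<le> u" "0 \<le> v" "u + v = 1" for x y u v
  proof (cases "x = y \<or> u = 0 \<or> v = 0")
    case True
    then show ?thesis
      using that scaleR_left_distrib[of u v y] distrib_right[of u v "f y"] by auto
  next
    case False
    with that have "x \<noteq> y" "0 < u" "0 < v" by auto
    then have "f (u *\<^sub>R x + v *\<^sub>R y) < u * f x + v * f y"
      using assms that unfolding strictly_convex_on_def by blast
    then show ?thesis by simp
  qed
  with assms show ?thesis by (auto simp: convex_on_def strictly_convex_on_def)
qed

lemma strictly_convex_on_subset:
  "strictly_convex_on S f \<Longrightarrow> T \<subseteq> S \<Longrightarrow> convex T \<Longrightarrow> strictly_convex_on T f"
  unfolding strictly_convex_on_def by blast

lemma concave_imp_time_sharing_unnecessary: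
  "concave_on {a..b} C \<Longrightarrow> time_sharing_unnecessary a b C"
  unfolding time_sharing_unnecessary_def is_upper_concave_envelope_def by blast

text \<open>The envelope is the chord through the end points.\<close>

lemma strictly_convex_imp_time_sharing_strict_gain:
  assumes "a < b" and C: "strictly_convex_on {a..b} C"
  shows "time_sharing_strict_gain a b C"
proof -
  define E where "E D = (b - D) / (b - a) * C a + (D - a) / (b - a) * C b" for D
  have comb: "(b - D) / (b - a) + (D - a) / (b - a) = 1"
    "(b - D) / (b - a) * a + (D - a) / (b - a) * b = D" for D
    using assms(1) by (auto simp: divide_simps) (simp_all add: algebra_simps)
  have less: "C D < E D" if "D \<in> {a<..<b}" for D
  proof -
    have "0 < (b - D) / (b - a)" "0 < (D - a) / (b - a)" "a \<in> {a..b}" "b \<in> {a..b}" "a \<noteq> b"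
      using that assms(1) by auto
    then have "C ((b - D) / (b - a) * a + (D - a) / (b - a) * b) < E D"
      using C comb(1)[of D] unfolding strictly_convex_on_def E_def real_scaleR_def by blast
    then show ?thesis by (simp only: comb)
  qed
  have ends: "E a = C a" "E b = C b" using assms(1) by (auto simp: E_def)
  have le: "C D \<le> E D" if "D \<in> {a..b}" for D
    using less[of D] ends that by (cases "D = a \<or> D = b") (auto simp: less_le)
  have "concave_on {a..b} E"
  proof -
    \<comment> \<open>The chord is affine, so its concavity holds with equality.\<close>
    have "E (u *\<^sub>R x + v *\<^sub>R y) = u * E x + v * E y" if uv: "u + v = 1" for x y u v
    proof -
      obtain c d where E: "E = (\<lambda>D. c + d * D)"
        by (rule that[of "(b * C a - a * C b) / (b - a)" "(C b - C a) / (b - a)"])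
          (auto simp: E_def fun_eq_iff diff_divide_distrib algebra_simps add_divide_distrib)
      have u: "u = 1 - v" using uv by simp
      show ?thesis unfolding E u by (simp add: algebra_simps)
    qed
    then show ?thesis by (simp add: concave_on_iff)
  qed
  \<comment> \<open>A concave majorant dominates \<open>C\<close> at both end points, hence lies
    above the chord joining the values there.\<close>
  moreover have "E D \<le> g D" if g: "concave_on {a..b} g" "\<forall>x\<in>{a..b}. C x \<le> g x" and D: "D \<in> {a..b}" for g D
  proof -
    have ab: "a \<in> {a..b}" "b \<in> {a..b}" using assms(1) by auto
    have c: "0 \<le> (b - D) / (b - a)" "0 \<le> (D - a) / (b - a)" using D by auto
    have "E D \<le> (b - D) / (b - a) * g a + (D - a) / (b - a) * g b"
      unfolding E_def using c g(2) assms(1) by (intro add_mono mult_left_mono) auto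
    also have "\<dots> \<le> g ((b - D) / (b - a) * a + (D - a) / (b - a) * b)"
      using g(1) c comb(1)[of D] ab unfolding concave_on_iff real_scaleR_def by blast
    finally show ?thesis by (simp only: comb)
  qed
  ultimately show ?thesis
    using le less unfolding time_sharing_strict_gain_def is_upper_concave_envelope_def by blast
qed

lemma single_mode_boundary_at:
  "inj_on G {1/2..1} \<Longrightarrow> p \<in> {1/2..1} \<Longrightarrow> single_mode_boundary R G (G p) = R p"
  unfolding single_mode_boundary_def by (subst the_inv_into_f_f) auto

lemma range_on_unit_half:
  fixes G :: "real \<Rightarrow> real"
  assumes "continuous_on {1/2..1} G" "D \<in> {G (1/2)..G 1}"
  obtains p where "p \<in> {1/2..1}" "D = G p"
  using IVT'[of G "1/2" D 1] assms by auto

text \<open>\<open>p\<close> is used as a parameter of the curve (G p, R p): three abscissae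
  correspond to three ordered priors, and the slope inequality is read off there. The closed
  interval is kept because the envelope arguments use the end points.\<close>

lemma single_mode_boundary_slopes:
  assumes cont: "continuous_on {1/2..1} G" and inc: "strict_mono_on {1/2..1} G"
    and sl: "\<And>p q r. 1/2 \<le> p \<Longrightarrow> p < q \<Longrightarrow> q < r \<Longrightarrow> r \<le> 1 \<Longrightarrow>
      (R q - R p) * (G r - G q) < (R r - R q) * (G q - G p)"
  shows "strictly_convex_on {G (1/2)..G 1} (single_mode_boundary R G)"
proof (rule strictly_convex_on_slopesI)
  fix x y z assume "x \<in> {G (1/2)..G 1}" "z \<in> {G (1/2)..G 1}" "x < y" "y < z"
  moreover from this have "y \<in> {G (1/2)..G 1}" by auto
  ultimately obtain p q r where p: "p \<in> {1/2..1}" "x = G p" and q: "q \<in> {1/2..1}" "y = G q"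
    and r: "r \<in> {1/2..1}" "z = G r" using range_on_unit_half[OF cont] by metis
  have "p < q" "q < r"
    using \<open>x < y\<close> \<open>y < z\<close> strict_mono_on_less[OF inc] p q r by auto
  then show "(single_mode_boundary R G y - single_mode_boundary R G x) * (z - y)
    < (single_mode_boundary R G z - single_mode_boundary R G y) * (y - x)"
    using sl[of p q r] p q r single_mode_boundary_at[OF strict_mono_on_imp_inj_on[OF inc]] by simp
qed simp

section \<open>Complex Gaussian measures\<close>

lemma nn_integral_lborel_affine:
  fixes f :: "'a::euclidean_space \<Rightarrow> ennreal"
  assumes [measurable]: "f \<in> borel_measurable borel" and "c \<noteq> 0"
  shows "(\<integral>\<^sup>+x. f x \<partial>lborel) = ennreal (\<bar>c\<bar> ^ DIM('a)) * (\<integral>\<^sup>+x. f (t + c *\<^sub>R x) \<partial>lborel)"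
  by (subst lborel_affine[OF assms(2), of t])
     (simp add: nn_integral_density nn_integral_distr nn_integral_cmult)

text \<open>\<open>complex_gaussian\<close> is defined by coordinates; this link gives it a density
  over \<open>lborel\<close> on \<open>complex\<close>. That measure is characterised by its values
  on boxes, with sides along 1 and \<i>.\<close>

lemma lborel_complex: "(lborel :: complex measure) = distr (lborel \<Otimes>\<^sub>M lborel) borel (\<lambda>(x, y). Complex x y)"
proof (rule lborel_eqI)
  fix l u :: complex
  assume le: "\<And>b. b \<in> Basis \<Longrightarrow> l \<bullet> b \<le> u \<bullet> b"
  have le': "Re l \<le> Re u" "Im l \<le> Im u" using le[of 1] le[of \<i>] by (auto simp: Basis_complex_def)
  have "(\<lambda>(x, y). Complex x y) -` box l u \<inter> space (lborel \<Otimes>\<^sub>M lborel)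
      = box (Re l) (Re u) \<times> box (Im l) (Im u)"
    by (auto simp: box_def Basis_complex_def space_pair_measure)
  then have "emeasure (distr (lborel \<Otimes>\<^sub>M lborel) borel (\<lambda>(x, y). Complex x y)) (box l u)
      = emeasure (lborel \<Otimes>\<^sub>M lborel) (box (Re l) (Re u) \<times> box (Im l) (Im u))"
    by (subst emeasure_distr) auto
  also have "\<dots> = ennreal (\<Prod>b\<in>Basis. (u - l) \<bullet> b)"
    using le' by (simp add: lborel.emeasure_pair_measure_Times Basis_complex_def ennreal_mult')
  finally show "emeasure (distr (lborel \<Otimes>\<^sub>M lborel) borel (\<lambda>(x, y). Complex x y)) (box l u)
      = ennreal (\<Prod>b\<in>Basis. (u - l) \<bullet> b)" .
qed simp

definition complex_gaussian_density :: "real \<Rightarrow> complex \<Rightarrow> real" where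
  "complex_gaussian_density v z = exp (- (cmod z)\<^sup>2 / v) / (pi * v)"

lemma complex_gaussian_density_measurable [measurable]:
  "complex_gaussian_density v \<in> borel_measurable borel"
  unfolding complex_gaussian_density_def by measurable

lemma complex_gaussian_density_pos: "0 < v \<Longrightarrow> 0 < complex_gaussian_density v z"
  by (simp add: complex_gaussian_density_def)

lemma complex_gaussian_eq_density:
  assumes "0 < v"
  shows "complex_gaussian v = density lborel (\<lambda>z. ennreal (complex_gaussian_density v z))"
proof -
  define f where "f = normal_density 0 (sqrt (v / 2))"
  have [measurable]: "f \<in> borel_measurable borel" by (simp add: f_def)
  interpret D: prob_space "density lborel f"
    unfolding f_def using assms by (intro prob_space_normal_density) simp
  have "complex_gaussian v = distr (density (lborel \<Otimes>\<^sub>M lborel) (\<lambda>(x, y). ennreal (f x) * ennreal (f y)))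
      borel (\<lambda>(x, y). Complex x y)"
    unfolding complex_gaussian_def f_def[symmetric]
    by (subst pair_measure_density) (auto intro: D.sigma_finite_measure_axioms lborel.sigma_finite_measure_axioms)
  also have "(\<lambda>(x, y). ennreal (f x) * ennreal (f y))
      = (\<lambda>z. ennreal (complex_gaussian_density v z)) \<circ> (\<lambda>(x, y). Complex x y)"
  proof -
    have "f x * f y = complex_gaussian_density v (Complex x y)" for x y
      using assms by (simp add: f_def normal_density_def complex_gaussian_density_def cmod_power2
          real_sqrt_mult_self add_divide_distrib flip: exp_add)
        (simp add: field_simps flip: real_sqrt_mult)
    then show ?thesis by (auto simp: fun_eq_iff ennreal_mult'[symmetric] f_def)
  qed
  also have "distr (density (lborel \<Otimes>\<^sub>M lborel) \<dots>) borel (\<lambda>(x, y). Complex x y)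
      = density (distr (lborel \<Otimes>\<^sub>M lborel) borel (\<lambda>(x, y). Complex x y)) (\<lambda>z. ennreal (complex_gaussian_density v z))"
    by (subst density_distr) (auto simp: o_def)
  finally show ?thesis by (simp flip: lborel_complex)
qed

lemma sets_complex_gaussian [measurable_cong, simp]: "sets (complex_gaussian v) = sets borel"
  by (simp add: complex_gaussian_def)

lemma space_complex_gaussian [simp]: "space (complex_gaussian v) = UNIV"
  by (simp add: complex_gaussian_def)

lemma nn_integral_complex_gaussian:
  assumes "0 < v" and [measurable]: "f \<in> borel_measurable borel"
  shows "(\<integral>\<^sup>+z. f z \<partial>complex_gaussian v) = (\<integral>\<^sup>+z. ennreal (complex_gaussian_density v z) * f z \<partial>lborel)"
  unfolding complex_gaussian_eq_density[OF assms(1)] by (subst nn_integral_density) auto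

lemma nn_integral_complex_gaussian_translate:
  assumes "0 < v" and [measurable]: "f \<in> borel_measurable borel"
  shows "(\<integral>\<^sup>+z. f (a + z) \<partial>complex_gaussian v)
    = (\<integral>\<^sup>+z. ennreal (complex_gaussian_density v (z - a)) * f z \<partial>lborel)"
  by (subst nn_integral_lborel_affine[where c=1 and t=a])
    (auto simp: nn_integral_complex_gaussian[OF assms(1)])

lemma nn_integral_complex_gaussian_scale:
  assumes "0 < v" "0 < c" and [measurable]: "f \<in> borel_measurable borel"
  shows "(\<integral>\<^sup>+z. f z \<partial>complex_gaussian (c\<^sup>2 * v)) = (\<integral>\<^sup>+z. f (c *\<^sub>R z) \<partial>complex_gaussian v)"
proof -
  have [measurable]: "(\<lambda>z. f (c *\<^sub>R z)) \<in> borel_measurable borel" by measurable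
  have "(\<integral>\<^sup>+z. f z \<partial>complex_gaussian (c\<^sup>2 * v)) = ennreal (\<bar>c\<bar> ^ DIM(complex)) *
    (\<integral>\<^sup>+z. ennreal (complex_gaussian_density (c\<^sup>2 * v) (0 + c *\<^sub>R z)) * f (0 + c *\<^sub>R z) \<partial>lborel)"
    using assms by (subst nn_integral_complex_gaussian, simp, simp)
      (subst nn_integral_lborel_affine[where c=c and t=0], auto)
  also have "\<dots> = (\<integral>\<^sup>+z. ennreal (\<bar>c\<bar> ^ 2) *
      (ennreal (complex_gaussian_density (c\<^sup>2 * v) (c *\<^sub>R z)) * f (c *\<^sub>R z)) \<partial>lborel)"
    by (subst nn_integral_cmult) auto
  also have "\<dots> = (\<integral>\<^sup>+z. ennreal (complex_gaussian_density v z) * f (c *\<^sub>R z) \<partial>lborel)"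
  proof (rule nn_integral_cong)
    fix z
    have "c\<^sup>2 * complex_gaussian_density (c\<^sup>2 * v) (c *\<^sub>R z) = complex_gaussian_density v z"
      using assms by (simp add: complex_gaussian_density_def power_mult_distrib)
    then show "ennreal (\<bar>c\<bar> ^ 2) * (ennreal (complex_gaussian_density (c\<^sup>2 * v) (c *\<^sub>R z)) * f (c *\<^sub>R z))
      = ennreal (complex_gaussian_density v z) * f (c *\<^sub>R z)"
      by (simp add: mult.assoc[symmetric] ennreal_mult'[symmetric])
  qed
  finally show ?thesis by (simp add: nn_integral_complex_gaussian[OF assms(1)])
qed

lemma distr_uminus_complex_gaussian:
  assumes "0 < v"
  shows "distr (complex_gaussian v) borel uminus = complex_gaussian v"
proof (rule measure_eqI)
  fix A assume "A \<in> sets (distr (complex_gaussian v) borel uminus)"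
  then have [measurable]: "A \<in> sets borel" by simp
  have "emeasure (distr (complex_gaussian v) borel uminus) A
      = (\<integral>\<^sup>+z. indicator A z \<partial>distr (complex_gaussian v) borel uminus)" by simp
  also have "\<dots> = (\<integral>\<^sup>+z. indicator A (- z) \<partial>complex_gaussian v)"
    by (subst nn_integral_distr) auto
  also have "\<dots> = (\<integral>\<^sup>+z. ennreal (complex_gaussian_density v z) * indicator A z \<partial>lborel)"
    using assms by (subst nn_integral_lborel_affine[where c="-1" and t=0])
      (auto simp: nn_integral_complex_gaussian complex_gaussian_density_def)
  also have "\<dots> = emeasure (complex_gaussian v) A"
    using assms by (simp add: nn_integral_complex_gaussian[symmetric])
  finally show "emeasure (distr (complex_gaussian v) borel uminus) A = emeasure (complex_gaussian v) A" .
qed simp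

text \<open>The rotation is factored into two affine substitutions, each in one variable with the
  other fixed, separated by Fubini. Their Jacobians are inverse to each other; the factorisation
  divides by \<open>c\<close>.\<close>

lemma nn_integral_lborel_rotate:
  fixes H :: "'a::euclidean_space \<times> 'a \<Rightarrow> ennreal"
  assumes [measurable]: "H \<in> borel_measurable (borel \<Otimes>\<^sub>M borel)" and cd: "c\<^sup>2 + d\<^sup>2 = 1" "c \<noteq> 0"
  shows "(\<integral>\<^sup>+z. \<integral>\<^sup>+w. H (c *\<^sub>R z + d *\<^sub>R w, c *\<^sub>R w - d *\<^sub>R z) \<partial>lborel \<partial>lborel) = (\<integral>\<^sup>+z. \<integral>\<^sup>+w. H (z, w) \<partial>lborel \<partial>lborel)"
proof -
  define k where "k = ennreal (\<bar>c\<bar> ^ DIM('a))"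
  have kk: "ennreal (\<bar>1 / c\<bar> ^ DIM('a)) * k = 1"
    using cd by (simp add: k_def ennreal_mult'[symmetric] power_mult_distrib[symmetric])
  have cc: "c * c + d * d = 1" using cd by (simp add: power2_eq_square)
  have "(\<integral>\<^sup>+z. \<integral>\<^sup>+w. H (z, w) \<partial>lborel \<partial>lborel)
    = (\<integral>\<^sup>+z. ennreal (\<bar>1 / c\<bar> ^ DIM('a)) * (\<integral>\<^sup>+w. H (z, - (d / c) *\<^sub>R z + (1 / c) *\<^sub>R w) \<partial>lborel) \<partial>lborel)"
    using cd by (intro nn_integral_cong nn_integral_lborel_affine) auto
  also have "\<dots> = ennreal (\<bar>1 / c\<bar> ^ DIM('a)) *
      (\<integral>\<^sup>+w. \<integral>\<^sup>+z. H (z, - (d / c) *\<^sub>R z + (1 / c) *\<^sub>R w) \<partial>lborel \<partial>lborel)"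
    by (subst nn_integral_cmult, measurable)
      (subst lborel_pair.Fubini', auto)
  also have "(\<integral>\<^sup>+w. \<integral>\<^sup>+z. H (z, - (d / c) *\<^sub>R z + (1 / c) *\<^sub>R w) \<partial>lborel \<partial>lborel)
    = (\<integral>\<^sup>+w. k * (\<integral>\<^sup>+z. H (d *\<^sub>R w + c *\<^sub>R z, - (d / c) *\<^sub>R (d *\<^sub>R w + c *\<^sub>R z) + (1 / c) *\<^sub>R w) \<partial>lborel) \<partial>lborel)"
    unfolding k_def using cd by (intro nn_integral_cong nn_integral_lborel_affine) auto
  also have "\<dots> = k * (\<integral>\<^sup>+w. \<integral>\<^sup>+z. H (d *\<^sub>R w + c *\<^sub>R z, - (d / c) *\<^sub>R (d *\<^sub>R w + c *\<^sub>R z) + (1 / c) *\<^sub>R w) \<partial>lborel \<partial>lborel)"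
    by (subst nn_integral_cmult) auto
  also have "(\<lambda>w z. H (d *\<^sub>R w + c *\<^sub>R z, - (d / c) *\<^sub>R (d *\<^sub>R w + c *\<^sub>R z) + (1 / c) *\<^sub>R w))
    = (\<lambda>w z. H (c *\<^sub>R z + d *\<^sub>R w, c *\<^sub>R w - d *\<^sub>R z))"
  proof (intro ext arg_cong[where f=H] prod_eqI; simp)
    fix w z :: 'a
    have "1 / c - d * d / c = c" using cc cd(2) by (simp add: field_simps)
    then have "c *\<^sub>R w = (1 / c) *\<^sub>R w - (d * d / c) *\<^sub>R w" by (metis scaleR_left_diff_distrib)
    then show "(1 / c) *\<^sub>R w - (d / c) *\<^sub>R (d *\<^sub>R w + c *\<^sub>R z) = c *\<^sub>R w - d *\<^sub>R z"
      using cd(2) by (simp add: scaleR_add_right)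
  qed
  finally show ?thesis
    using kk by (subst lborel_pair.Fubini') (auto simp: mult.assoc[symmetric])
qed

text \<open>The joint density of two independent copies depends only on the sum of squared moduli,
  which the rotation preserves.\<close>

lemma nn_integral_complex_gaussian_rotate:
  assumes [measurable]: "F \<in> borel_measurable (borel \<Otimes>\<^sub>M borel)" and cd: "c\<^sup>2 + d\<^sup>2 = 1" "c \<noteq> 0" and v: "0 < v"
  shows "(\<integral>\<^sup>+z. \<integral>\<^sup>+w. F (c *\<^sub>R z + d *\<^sub>R w, c *\<^sub>R w - d *\<^sub>R z) \<partial>complex_gaussian v \<partial>complex_gaussian v)
    = (\<integral>\<^sup>+z. \<integral>\<^sup>+w. F (z, w) \<partial>complex_gaussian v \<partial>complex_gaussian v)"
proof -
  define K where "K z w = ennreal (complex_gaussian_density v z) * ennreal (complex_gaussian_density v w)" for z w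
  have [measurable]: "(\<lambda>(z, w). K z w) \<in> borel_measurable (borel \<Otimes>\<^sub>M borel)" unfolding K_def by measurable
  have *: "(\<integral>\<^sup>+z. \<integral>\<^sup>+w. E (z, w) \<partial>complex_gaussian v \<partial>complex_gaussian v)
    = (\<integral>\<^sup>+z. \<integral>\<^sup>+w. K z w * E (z, w) \<partial>lborel \<partial>lborel)"
    if [measurable]: "E \<in> borel_measurable (borel \<Otimes>\<^sub>M borel)" for E
  proof -
    interpret prob_space "complex_gaussian v" using v by (rule prob_space_complex_gaussian)
    have "(\<integral>\<^sup>+z. \<integral>\<^sup>+w. E (z, w) \<partial>complex_gaussian v \<partial>complex_gaussian v)
      = (\<integral>\<^sup>+z. ennreal (complex_gaussian_density v z) * (\<integral>\<^sup>+w. E (z, w) \<partial>complex_gaussian v) \<partial>lborel)"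
      using v by (intro nn_integral_complex_gaussian) auto
    also have "\<dots> = (\<integral>\<^sup>+z. \<integral>\<^sup>+w. K z w * E (z, w) \<partial>lborel \<partial>lborel)"
      using v by (intro nn_integral_cong)
        (simp add: nn_integral_complex_gaussian nn_integral_cmult[symmetric] K_def mult.assoc)
    finally show ?thesis .
  qed
  have K: "K z w = K (c *\<^sub>R z + d *\<^sub>R w) (c *\<^sub>R w - d *\<^sub>R z)" for z w
  proof -
    have "(cmod (c *\<^sub>R z + d *\<^sub>R w))\<^sup>2 + (cmod (c *\<^sub>R w - d *\<^sub>R z))\<^sup>2 = (c\<^sup>2 + d\<^sup>2) * ((cmod z)\<^sup>2 + (cmod w)\<^sup>2)"
      unfolding cmod_power2 by (simp add: power2_eq_square algebra_simps)
    then have "- (cmod z)\<^sup>2 / v + - (cmod w)\<^sup>2 / v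
        = - (cmod (c *\<^sub>R z + d *\<^sub>R w))\<^sup>2 / v + - (cmod (c *\<^sub>R w - d *\<^sub>R z))\<^sup>2 / v"
      using cd v by (simp add: field_simps)
    then have "exp (- (cmod z)\<^sup>2 / v) * exp (- (cmod w)\<^sup>2 / v)
        = exp (- (cmod (c *\<^sub>R z + d *\<^sub>R w))\<^sup>2 / v) * exp (- (cmod (c *\<^sub>R w - d *\<^sub>R z))\<^sup>2 / v)"
      by (simp only: exp_add[symmetric])
    then show ?thesis
      using v by (simp add: K_def complex_gaussian_density_def ennreal_mult'[symmetric])
  qed
  show ?thesis
    using nn_integral_lborel_rotate[of "\<lambda>(z, w). K z w * F (z, w)", OF _ cd]
      *[of "\<lambda>(z, w). F (c *\<^sub>R z + d *\<^sub>R w, c *\<^sub>R w - d *\<^sub>R z)"]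
    by (simp add: *[OF assms(1)] K[symmetric])
qed

section \<open>From complex Gaussians to exponential variables\<close>

text \<open>A disc of radius sqrt a has area pi a, and half-lines determine the measure.
  Consequently the squared modulus of a standard complex Gaussian is exponential with rate
  1.\<close>

lemma distr_cmod_power2_lborel:
  "distr lborel borel (\<lambda>z::complex. (cmod z)\<^sup>2) = density lborel (\<lambda>x. ennreal (pi * indicator {0<..} x))"
proof (rule measure_eqI_generator_eq[where E="range (\<lambda>a::real. {..a})" and \<Omega>=UNIV and A="\<lambda>n. {..real n}"])
  show "Int_stable (range (\<lambda>a::real. {..a}))"
    by (auto simp: Int_stable_def)
  have l: "emeasure (distr lborel borel (\<lambda>z::complex. (cmod z)\<^sup>2)) {..a} = ennreal (pi * max 0 a)" for a
  proof (cases "0 \<le> a")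
    case True
    then have "(\<lambda>z::complex. (cmod z)\<^sup>2) -` {..a} \<inter> space lborel = cball 0 (sqrt a)"
      by (auto simp: real_le_rsqrt real_sqrt_ge_0_iff dest!: power_mono[of _ "sqrt a" 2])
    then show ?thesis
      using True by (simp add: emeasure_distr emeasure_cball unit_ball_vol_numeral)
  next
    case False
    then have "\<not> (cmod z)\<^sup>2 \<le> a" for z
      using zero_le_power2[of "cmod z"] by linarith
    then have "(\<lambda>z::complex. (cmod z)\<^sup>2) -` {..a} \<inter> space lborel = {}"
      by auto
    with False show ?thesis by (simp add: emeasure_distr)
  qed
  have r: "emeasure (density lborel (\<lambda>x. ennreal (pi * indicator {0<..} x))) {..a} = ennreal (pi * max 0 a)" for a
  proof -
    have "emeasure (density lborel (\<lambda>x. ennreal (pi * indicator {0<..} x))) {..a}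
      = (\<integral>\<^sup>+x. ennreal pi * indicator {0<..a} x \<partial>lborel)"
      by (subst emeasure_density) (auto intro!: nn_integral_cong simp: indicator_def)
    also have "\<dots> = ennreal pi * emeasure lborel {0<..a}" by (rule nn_integral_cmult_indicator) simp
    also have "\<dots> = ennreal (pi * max 0 a)" by (cases "0 \<le> a") (auto simp: ennreal_mult')
    finally show ?thesis .
  qed
  show "emeasure (distr lborel borel (\<lambda>z::complex. (cmod z)\<^sup>2)) X
      = emeasure (density lborel (\<lambda>x. ennreal (pi * indicator {0<..} x))) X"
    if "X \<in> range (\<lambda>a::real. {..a})" for X using that l r by auto
  show "emeasure (distr lborel borel (\<lambda>z::complex. (cmod z)\<^sup>2)) {..real n} \<noteq> \<infinity>" for n by (simp add: l)
  show "(\<Union>n. {..real n}) = UNIV" by (auto intro: real_arch_simple)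
qed (auto simp: borel_eq_atMost)

lemma nn_integral_complex_gaussian_cmod_power2:
  assumes [measurable]: "f \<in> borel_measurable borel"
  shows "(\<integral>\<^sup>+z. f ((cmod z)\<^sup>2) \<partial>complex_gaussian 1)
    = (\<integral>\<^sup>+x. ennreal (indicator {0<..} x * exp (- x)) * f x \<partial>lborel)"
proof -
  have "(\<integral>\<^sup>+z. f ((cmod z)\<^sup>2) \<partial>complex_gaussian 1)
    = (\<integral>\<^sup>+x. ennreal (exp (- x) / pi) * f x \<partial>distr lborel borel (\<lambda>z::complex. (cmod z)\<^sup>2))"
    by (subst nn_integral_complex_gaussian)
      (auto simp: nn_integral_distr complex_gaussian_density_def)
  also have "\<dots> = (\<integral>\<^sup>+x. ennreal (indicator {0<..} x * exp (- x)) * f x \<partial>lborel)"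
    unfolding distr_cmod_power2_lborel
    by (subst nn_integral_density) (auto intro!: nn_integral_cong simp: indicator_def mult.assoc[symmetric] ennreal_mult'[symmetric])
  finally show ?thesis .
qed

lemma nn_integral_exp_Ici:
  assumes "0 < (k::real)"
  shows "(\<integral>\<^sup>+y. ennreal (indicator {m..} y * exp (- k * y)) \<partial>lborel) = ennreal (exp (- k * m) / k)"
proof -
  have "(\<integral>\<^sup>+y. ennreal (exp (- k * y)) * indicator {m..} y \<partial>lborel) = ennreal (0 - (- exp (- k * m) / k))"
  proof (rule nn_integral_FTC_atLeast)
    show "((\<lambda>y. - exp (- k * y) / k) has_real_derivative exp (- k * x)) (at x)" for x
      using assms by (auto intro!: derivative_eq_intros)
    have "((\<lambda>y. exp (- k * y)) \<longlongrightarrow> 0) at_top"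
      using assms by (intro filterlim_compose[OF exp_at_bot] filterlim_tendsto_neg_mult_at_bot[OF tendsto_const _ filterlim_ident]) auto
    from tendsto_divide[OF tendsto_minus[OF this] tendsto_const[of k]]
    show "((\<lambda>y. - exp (- k * y) / k) \<longlongrightarrow> 0) at_top" using assms by simp
  qed auto
  then show ?thesis by (simp add: mult.commute indicator_mult_ennreal ennreal_mult'[symmetric] ennreal_indicator[symmetric])
qed

text \<open>Substitute t = a x - b y for x, exchange the integrals, and integrate out y for fixed t.
  The two branches arise from which of x > 0 and y > 0 is the binding constraint.\<close>

lemma nn_integral_exponential_difference:
  fixes a b :: real
  assumes [measurable]: "G \<in> borel_measurable borel" and ab: "0 < a" "0 < b"
  shows "(\<integral>\<^sup>+x. ennreal (indicator {0<..} x * exp (- x)) *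
      (\<integral>\<^sup>+y. ennreal (indicator {0<..} y * exp (- y)) * G (a * x - b * y) \<partial>lborel) \<partial>lborel)
    = (\<integral>\<^sup>+t. ennreal (exp (if 0 \<le> t then - t / a else t / b) / (a + b)) * G t \<partial>lborel)"
proof -
  define e :: "real \<Rightarrow> ennreal" where "e x = ennreal (indicator {0<..} x * exp (- x))" for x
  have [measurable]: "e \<in> borel_measurable borel" unfolding e_def by measurable
  have "(\<integral>\<^sup>+x. e x * (\<integral>\<^sup>+y. e y * G (a * x - b * y) \<partial>lborel) \<partial>lborel)
    = (\<integral>\<^sup>+x. \<integral>\<^sup>+y. e x * (e y * G (a * x - b * y)) \<partial>lborel \<partial>lborel)"
    by (intro nn_integral_cong nn_integral_cmult[symmetric]) auto
  also have "\<dots> = (\<integral>\<^sup>+y. \<integral>\<^sup>+x. e x * (e y * G (a * x - b * y)) \<partial>lborel \<partial>lborel)"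
    by (rule lborel_pair.Fubini'[symmetric]) auto
  also have "\<dots> = (\<integral>\<^sup>+y. ennreal \<bar>1 / a\<bar> * (\<integral>\<^sup>+t. e (b * y / a + 1 / a * t) *
      (e y * G (a * (b * y / a + 1 / a * t) - b * y)) \<partial>lborel) \<partial>lborel)"
    using ab by (intro nn_integral_cong nn_integral_real_affine) auto
  also have "\<dots> = (\<integral>\<^sup>+y. \<integral>\<^sup>+t. ennreal (1 / a) * (e (b * y / a + 1 / a * t) * (e y * G t)) \<partial>lborel \<partial>lborel)"
    using ab by (subst nn_integral_cmult[symmetric]) (auto simp: algebra_simps)
  also have "\<dots> = (\<integral>\<^sup>+t. \<integral>\<^sup>+y. ennreal (1 / a) * (e (b * y / a + 1 / a * t) * (e y * G t)) \<partial>lborel \<partial>lborel)"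
    by (rule lborel_pair.Fubini') auto
  also have "\<dots> = (\<integral>\<^sup>+t. ennreal (exp (if 0 \<le> t then - t / a else t / b) / (a + b)) * G t \<partial>lborel)"
  proof (rule nn_integral_cong)
    fix t :: real
    \<comment> \<open>Both variables are positive exactly for y > m, and \<open>k\<close> is the
      rate in y left after the substitution x = (b y + t) / a.\<close>
    define m where "m = max 0 (- t / b)"
    define k where "k = (a + b) / a"
    have k: "0 < k" using ab by (simp add: k_def)
    have "(\<integral>\<^sup>+y. ennreal (1 / a) * (e (b * y / a + 1 / a * t) * (e y * G t)) \<partial>lborel)
      = (\<integral>\<^sup>+y. (ennreal (exp (- t / a) / a) * G t) * ennreal (indicator {m..} y * exp (- k * y)) \<partial>lborel)"
    proof (rule nn_integral_cong_AE)
      show "AE y in lborel. ennreal (1 / a) * (e (b * y / a + 1 / a * t) * (e y * G t))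
        = (ennreal (exp (- t / a) / a) * G t) * ennreal (indicator {m..} y * exp (- k * y))"
        \<comment> \<open>The open constraint y > m is replaced by the closed half-line
          \<open>{m..}\<close>, so the single point \<open>m\<close> is discarded.\<close>
        using AE_lborel_singleton[of m]
      proof eventually_elim
        case (elim y)
        have iff: "0 < y \<and> 0 < b * y / a + 1 / a * t \<longleftrightarrow> m \<le> y"
        proof -
          have "0 < b * y / a + 1 / a * t \<longleftrightarrow> - t / b < y"
            using ab by (auto simp: field_simps)
          with elim show ?thesis by (auto simp: m_def)
        qed
        have ex: "exp (- (b * y / a + 1 / a * t)) * exp (- y) = exp (- t / a) * exp (- k * y)"
          using ab by (simp add: k_def field_simps flip: exp_add)
        show ?case
        proof (cases "m \<le> y")
          case True
          with iff have "0 < y" "0 < b * y / a + 1 / a * t" by auto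
          then have "ennreal (1 / a) * (e (b * y / a + 1 / a * t) * (e y * G t))
            = ennreal (1 / a * (exp (- (b * y / a + 1 / a * t)) * exp (- y))) * G t"
            using ab by (simp add: e_def ennreal_mult'[symmetric] mult.assoc[symmetric])
          also have "\<dots> = ennreal (exp (- t / a) / a * exp (- k * y)) * G t"
            unfolding ex by simp
          also have "\<dots> = ennreal (exp (- t / a) / a) * ennreal (exp (- k * y)) * G t"
            using ab by (subst ennreal_mult') auto
          finally show ?thesis using True
            by (simp add: mult_ac)
        next
          case False
          with iff have "e (b * y / a + 1 / a * t) * e y = 0" by (auto simp: e_def indicator_def)
          then have "e (b * y / a + 1 / a * t) * (e y * G t) = 0" by (simp add: mult.assoc[symmetric])
          then show ?thesis using False by simp
        qed
      qed
    qed
    also have "\<dots> = ennreal (exp (- t / a) / a) * G t * ennreal (exp (- k * m) / k)"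
      by (subst nn_integral_cmult) (auto simp: nn_integral_exp_Ici[OF k, simplified])
    also have "\<dots> = ennreal (exp (- t / a) / a * (exp (- k * m) / k)) * G t"
      using ab k by (subst ennreal_mult') (simp_all add: mult_ac)
    also have "exp (- t / a) / a * (exp (- k * m) / k) = exp (if 0 \<le> t then - t / a else t / b) / (a + b)"
    proof -
      have "- t / a + - k * m = (if 0 \<le> t then - t / a else t / b)"
        using ab by (auto simp: m_def k_def max_def field_simps)
      moreover have "a * k = a + b" using ab by (simp add: k_def)
      moreover have "exp (- t / a) / a * (exp (- k * m) / k) = exp (- t / a + - k * m) / (a * k)"
        by (simp only: exp_add times_divide_times_eq)
      ultimately show ?thesis by simp
    qed
    finally show "(\<integral>\<^sup>+y. ennreal (1 / a) * (e (b * y / a + 1 / a * t) * (e y * G t)) \<partial>lborel)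
      = ennreal (exp (if 0 \<le> t then - t / a else t / b) / (a + b)) * G t" .
  qed
  finally show ?thesis unfolding e_def .
qed

text \<open>After scaling to unit variance, the sum is \<rho> times one coordinate of a rotated
  pair, and the other coordinate integrates to 1. A negative \<open>r\<close> covers the symbol
  -1.\<close>

lemma nn_integral_complex_gaussian_add:
  assumes pos: "0 < v" "0 < w" "r \<noteq> 0" and [measurable]: "E \<in> borel_measurable borel"
  shows "(\<integral>\<^sup>+a. \<integral>\<^sup>+n. E (r *\<^sub>R a + n) \<partial>complex_gaussian w \<partial>complex_gaussian v)
    = (\<integral>\<^sup>+z. E z \<partial>complex_gaussian (r\<^sup>2 * v + w))"
proof -
  interpret CN: prob_space "complex_gaussian 1" by (rule prob_space_complex_gaussian) simp
  interpret CN2: prob_space "complex_gaussian w" by (rule prob_space_complex_gaussian) (use pos in simp)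
  define \<rho> where "\<rho> = sqrt (r\<^sup>2 * v + w)"
  define c d where "c = r * sqrt v / \<rho>" and "d = sqrt w / \<rho>"
  have sum: "0 < r\<^sup>2 * v + w" using pos by (intro add_nonneg_pos) auto
  then have \<rho>: "0 < \<rho>" "\<rho>\<^sup>2 = r\<^sup>2 * v + w" by (auto simp: \<rho>_def)
  have "c\<^sup>2 + d\<^sup>2 = (r\<^sup>2 * v + w) / \<rho>\<^sup>2"
    using pos by (simp add: c_def d_def power_divide power_mult_distrib add_divide_distrib)
  then have cd: "c\<^sup>2 + d\<^sup>2 = 1" "c \<noteq> 0" using sum pos \<rho> by (auto simp: c_def)
  have eq: "r *\<^sub>R (sqrt v *\<^sub>R z) + sqrt w *\<^sub>R n = \<rho> *\<^sub>R (c *\<^sub>R z + d *\<^sub>R n)" for z n :: complex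
    using \<rho> by (simp add: c_def d_def scaleR_add_right)
  have "(\<integral>\<^sup>+a. \<integral>\<^sup>+n. E (r *\<^sub>R a + n) \<partial>complex_gaussian w \<partial>complex_gaussian v)
    = (\<integral>\<^sup>+z. \<integral>\<^sup>+n. E (r *\<^sub>R (sqrt v *\<^sub>R z) + sqrt w *\<^sub>R n) \<partial>complex_gaussian 1 \<partial>complex_gaussian 1)"
    using nn_integral_complex_gaussian_scale[of 1 "sqrt v" "\<lambda>a. \<integral>\<^sup>+n. E (r *\<^sub>R a + n) \<partial>complex_gaussian w"]
      nn_integral_complex_gaussian_scale[of 1 "sqrt w" "\<lambda>n. E (_ + n)"] pos by simp
  also have "\<dots> = (\<integral>\<^sup>+u. \<integral>\<^sup>+n. E (\<rho> *\<^sub>R u) \<partial>complex_gaussian 1 \<partial>complex_gaussian 1)"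
    unfolding eq using nn_integral_complex_gaussian_rotate[of "\<lambda>(u, n). E (\<rho> *\<^sub>R u)" c d 1] cd by simp
  also have "\<dots> = (\<integral>\<^sup>+z. E z \<partial>complex_gaussian (r\<^sup>2 * v + w))"
    using nn_integral_complex_gaussian_scale[of 1 \<rho> E] \<rho> by (simp add: CN.emeasure_space_1[simplified])
  finally show ?thesis .
qed

lemma integrable_complex_gaussian_cmod_power2:
  assumes "0 < v"
  shows "integrable (complex_gaussian v) (\<lambda>z. (cmod z)\<^sup>2)"
proof (rule integrableI_nonneg)
  have "(\<integral>\<^sup>+z. ennreal ((cmod z)\<^sup>2) \<partial>complex_gaussian v) = (\<integral>\<^sup>+z. ennreal (v * (cmod z)\<^sup>2) \<partial>complex_gaussian 1)"
    using nn_integral_complex_gaussian_scale[of 1 "sqrt v" "\<lambda>z. ennreal ((cmod z)\<^sup>2)"] assms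
    by (simp add: power_mult_distrib)
  also have "\<dots> = (\<integral>\<^sup>+x. ennreal (indicator {0<..} x * exp (- x)) * ennreal (v * x) \<partial>lborel)"
    by (rule nn_integral_complex_gaussian_cmod_power2) simp
  also have "\<dots> = (\<integral>\<^sup>+x. ennreal (indicator {0<..} x *\<^sub>R (v * (x * exp (- 1 * x)))) \<partial>lborel)"
    using assms by (intro nn_integral_cong) (auto simp: indicator_def ennreal_mult'[symmetric] mult_ac)
  also have "\<dots> < \<infinity>"
    using set_integrable_mult_right[OF set_integrable_power_exp[of 1], of v] assms unfolding set_integrable_def
    by (subst nn_integral_eq_integral) (auto simp: indicator_def)
  finally show "(\<integral>\<^sup>+z. ennreal ((cmod z)\<^sup>2) \<partial>complex_gaussian v) < \<infinity>" .
qed auto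

section \<open>The law of the log-likelihood ratio\<close>

text \<open>Half the log-likelihood ratio of the two symbols, as a function of the coefficient \<open>a\<close> and the
  noise \<open>n\<close>, when the symbol \<open>+1\<close> is sent; sending \<open>-1\<close> amounts to replacing \<open>a\<close> by \<open>- a\<close>.\<close>

definition llr :: "real \<Rightarrow> real \<Rightarrow> complex \<Rightarrow> complex \<Rightarrow> real" where
  "llr P \<sigma> a n = (2 * P * (cmod a)\<^sup>2 + 2 * sqrt P * (a \<bullet> n)) / \<sigma>\<^sup>2"

text \<open>A two-sided exponential law with rate s - 1 on the right and s + 1 on the left. The
  values at t and - t have ratio exp (2 t), as befits half a log-likelihood ratio.\<close>

definition llr_density :: "real \<Rightarrow> real \<Rightarrow> real" where
  "llr_density s t = (s\<^sup>2 - 1) / (2 * s) * exp (t - s * \<bar>t\<bar>)"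

lemma llr_measurable [measurable]: "(\<lambda>(a, n). llr P \<sigma> a n) \<in> borel_measurable (borel \<Otimes>\<^sub>M borel)"
  unfolding llr_def by measurable

lemma llr_density_measurable [measurable]: "llr_density s \<in> borel_measurable borel"
  unfolding llr_density_def by measurable

text \<open>With g = P \<Omega> / \<open>\<sigma>\<^sup>2\<close> and unit-variance variables z, w,
  the form is 2 g \<bar>z\<bar>^2 + 2 sqrt g (z . w). Its matrix has eigenvalues g + sqrt (g^2 + g)
  and g - sqrt (g^2 + g), which for s^2 = 1 + 1 / g are 1 / (s - 1) and - 1 / (s + 1).\<close>

lemma nn_integral_llr:
  assumes pos: "0 < P" "0 < \<Omega>" "0 < \<sigma>" and [measurable]: "G \<in> borel_measurable borel"
  defines "s \<equiv> sqrt (1 + 2 / (2 * P * \<Omega> / \<sigma>\<^sup>2))"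
  shows "(\<integral>\<^sup>+a. \<integral>\<^sup>+n. G (llr P \<sigma> a n) \<partial>complex_gaussian (\<sigma>\<^sup>2) \<partial>complex_gaussian \<Omega>)
    = (\<integral>\<^sup>+t. ennreal (llr_density s t) * G t \<partial>lborel)"
proof -
  interpret CN: prob_space "complex_gaussian 1" by (rule prob_space_complex_gaussian) simp
  interpret CN2: prob_space "complex_gaussian (\<sigma>\<^sup>2)" by (rule prob_space_complex_gaussian) (use pos in simp)
  have s2: "s\<^sup>2 = 1 + \<sigma>\<^sup>2 / (P * \<Omega>)" and s1: "1 < s"
    using pos unfolding s_def by (auto simp: add_nonneg_nonneg zero_less_divide_iff)
  have "s\<^sup>2 - 1 = 1 / (P * \<Omega> / \<sigma>\<^sup>2)" unfolding s2 by simp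
  then have g: "P * \<Omega> / \<sigma>\<^sup>2 = 1 / (s\<^sup>2 - 1)" by simp
  \<comment> \<open>The positive eigenvalue is \<open>a\<close>, the negative one is
    \<open>- b\<close>; \<open>c\<close> and \<open>d\<close> below are the entries of the
    normalised eigenvector for \<open>a\<close>.\<close>
  define a b where "a = 1 / (s - 1)" and "b = 1 / (s + 1)"
  define c d where "c = sqrt ((s + 1) / (2 * s))" and "d = sqrt ((s - 1) / (2 * s))"
  have ab: "0 < a" "0 < b" using s1 by (auto simp: a_def b_def)
  have c2: "c\<^sup>2 = (s + 1) / (2 * s)" and d2: "d\<^sup>2 = (s - 1) / (2 * s)" using s1 by (auto simp: c_def d_def)
  have cd: "c\<^sup>2 + d\<^sup>2 = 1" using s1 unfolding c2 d2 by (simp add: field_simps)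
  have c0: "c \<noteq> 0" using s1 by (simp add: c_def)
  have sq: "sqrt (P * \<Omega>) / \<sigma> = 1 / sqrt (s\<^sup>2 - 1)"
    using arg_cong[OF g, of sqrt] pos by (simp add: real_sqrt_divide)
  have ss: "0 < s\<^sup>2 - 1" using s1 by simp
  have quad: "llr P \<sigma> (sqrt \<Omega> *\<^sub>R z) (\<sigma> *\<^sub>R w)
      = a * (cmod (c *\<^sub>R z + d *\<^sub>R w))\<^sup>2 - b * (cmod (c *\<^sub>R w - d *\<^sub>R z))\<^sup>2" for z w
  proof -
    \<comment> \<open>Facts \<open>1\<close> and \<open>2\<close> match the coefficients of the
      diagonalised form: those of the squared moduli here, that of the inner product in
      \<open>2\<close>.\<close>
    have 1: "a * c\<^sup>2 - b * d\<^sup>2 = 2 / (s\<^sup>2 - 1)" "a * d\<^sup>2 - b * c\<^sup>2 = 0"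
      using s1 ss unfolding c2 d2 a_def b_def by (auto simp: field_simps power2_eq_square)
    have "c * d = sqrt ((s\<^sup>2 - 1) / (2 * s)\<^sup>2)"
      unfolding c_def d_def real_sqrt_mult[symmetric] by (simp add: power2_eq_square algebra_simps)
    also have "\<dots> = sqrt (s\<^sup>2 - 1) / (2 * s)" using s1 by (simp only: real_sqrt_divide real_sqrt_abs)
    finally have cd': "c * d = sqrt (s\<^sup>2 - 1) / (2 * s)" .
    have "a + b = 2 * s / (s\<^sup>2 - 1)"
      using s1 ss unfolding a_def b_def by (simp add: field_simps power2_eq_square)
    then have "2 * (c * d) * (a + b) = 2 * sqrt (s\<^sup>2 - 1) / (s\<^sup>2 - 1)"
      unfolding cd' using s1 by simp
    also have "\<dots> = 2 * (sqrt (s\<^sup>2 - 1) / (s\<^sup>2 - 1))" by (rule times_divide_eq_right[symmetric])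
    also have "\<dots> = 2 / sqrt (s\<^sup>2 - 1)"
      unfolding sqrt_divide_self_eq[OF less_imp_le[OF ss]] by (rule divide_inverse[symmetric])
    finally have 2: "2 * (c * d) * (a + b) = 2 / sqrt (s\<^sup>2 - 1)" .
    have "llr P \<sigma> (sqrt \<Omega> *\<^sub>R z) (\<sigma> *\<^sub>R w)
      = 2 * (P * \<Omega> / \<sigma>\<^sup>2) * (cmod z)\<^sup>2 + 2 * (sqrt (P * \<Omega>) / \<sigma>) * (z \<bullet> w)"
      using pos by (simp add: llr_def power_mult_distrib real_sqrt_mult field_simps power2_eq_square)
    also have "\<dots> = (a * c\<^sup>2 - b * d\<^sup>2) * (cmod z)\<^sup>2 + (a * d\<^sup>2 - b * c\<^sup>2) * (cmod w)\<^sup>2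
      + 2 * (c * d) * (a + b) * (z \<bullet> w)"
      unfolding 1 2 g sq by simp
    also have "\<dots> = a * (cmod (c *\<^sub>R z + d *\<^sub>R w))\<^sup>2 - b * (cmod (c *\<^sub>R w - d *\<^sub>R z))\<^sup>2"
      unfolding cmod_power2 by (simp add: inner_complex_def power2_eq_square algebra_simps)
    finally show ?thesis .
  qed
  have "(\<integral>\<^sup>+a. \<integral>\<^sup>+n. G (llr P \<sigma> a n) \<partial>complex_gaussian (\<sigma>\<^sup>2) \<partial>complex_gaussian \<Omega>)
    = (\<integral>\<^sup>+z. \<integral>\<^sup>+w. G (llr P \<sigma> (sqrt \<Omega> *\<^sub>R z) (\<sigma> *\<^sub>R w)) \<partial>complex_gaussian 1 \<partial>complex_gaussian 1)"
    using nn_integral_complex_gaussian_scale[of 1 "sqrt \<Omega>" "\<lambda>a. \<integral>\<^sup>+n. G (llr P \<sigma> a n) \<partial>complex_gaussian (\<sigma>\<^sup>2)"]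
      nn_integral_complex_gaussian_scale[of 1 \<sigma> "\<lambda>n. G (llr P \<sigma> _ n)"] pos by simp
  also have "\<dots> = (\<integral>\<^sup>+u. \<integral>\<^sup>+v. G (a * (cmod u)\<^sup>2 - b * (cmod v)\<^sup>2) \<partial>complex_gaussian 1 \<partial>complex_gaussian 1)"
    unfolding quad
    using nn_integral_complex_gaussian_rotate[of "\<lambda>(u, v). G (a * (cmod u)\<^sup>2 - b * (cmod v)\<^sup>2)" c d 1] cd c0 by simp
  also have "\<dots> = (\<integral>\<^sup>+u. (\<integral>\<^sup>+y. ennreal (indicator {0<..} y * exp (- y)) * G (a * (cmod u)\<^sup>2 - b * y) \<partial>lborel) \<partial>complex_gaussian 1)"
    by (intro nn_integral_cong nn_integral_complex_gaussian_cmod_power2) simp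
  also have "\<dots> = (\<integral>\<^sup>+x. ennreal (indicator {0<..} x * exp (- x)) *
      (\<integral>\<^sup>+y. ennreal (indicator {0<..} y * exp (- y)) * G (a * x - b * y) \<partial>lborel) \<partial>lborel)"
    by (intro nn_integral_complex_gaussian_cmod_power2) simp
  also have "\<dots> = (\<integral>\<^sup>+t. ennreal (exp (if 0 \<le> t then - t / a else t / b) / (a + b)) * G t \<partial>lborel)"
    by (intro nn_integral_exponential_difference ab) simp
  also have "\<dots> = (\<integral>\<^sup>+t. ennreal (llr_density s t) * G t \<partial>lborel)"
  proof (intro nn_integral_cong arg_cong2[where f="(*)"] arg_cong[where f=ennreal] refl)
    fix t
    have "1 / (a + b) = (s\<^sup>2 - 1) / (2 * s)"
      using s1 ss by (simp add: a_def b_def field_simps power2_eq_square)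
    then have "exp x / (a + b) = (s\<^sup>2 - 1) / (2 * s) * exp x" for x
      using times_divide_eq_left[of 1 "a + b" "exp x"] by (simp only: mult_1_left)
    moreover have "(if 0 \<le> t then - t / a else t / b) = t - s * \<bar>t\<bar>"
      by (simp add: a_def b_def algebra_simps)
    ultimately show "exp (if 0 \<le> t then - t / a else t / b) / (a + b) = llr_density s t"
      unfolding llr_density_def by (simp only:)
  qed
  finally show ?thesis .
qed

lemma distr_llr:
  assumes pos: "0 < P" "0 < \<Omega>" "0 < \<sigma>"
  defines "s \<equiv> sqrt (1 + 2 / (2 * P * \<Omega> / \<sigma>\<^sup>2))"
  shows "distr (complex_gaussian \<Omega> \<Otimes>\<^sub>M complex_gaussian (\<sigma>\<^sup>2)) borel (\<lambda>(a, n). llr P \<sigma> a n)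
    = density lborel (llr_density s)"
proof (rule measure_eqI)
  interpret CN2: prob_space "complex_gaussian (\<sigma>\<^sup>2)" by (rule prob_space_complex_gaussian) (use pos in simp)
  let ?D = "distr (complex_gaussian \<Omega> \<Otimes>\<^sub>M complex_gaussian (\<sigma>\<^sup>2)) borel (\<lambda>(a, n). llr P \<sigma> a n)"
  fix A assume "A \<in> sets ?D"
  then have [measurable]: "A \<in> sets borel" by simp
  have "emeasure ?D A = (\<integral>\<^sup>+x. indicator A x \<partial>?D)" by simp
  also have "\<dots> = (\<integral>\<^sup>+a. \<integral>\<^sup>+n. indicator A (llr P \<sigma> a n) \<partial>complex_gaussian (\<sigma>\<^sup>2) \<partial>complex_gaussian \<Omega>)"
    by (subst nn_integral_distr) (auto simp: CN2.nn_integral_fst[symmetric] split_beta')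
  also have "\<dots> = emeasure (density lborel (llr_density s)) A"
    unfolding s_def by (subst nn_integral_llr[OF pos]) (auto simp: emeasure_density)
  finally show "emeasure ?D A = emeasure (density lborel (llr_density s)) A" .
qed simp

section \<open>Expected information loss under the log-likelihood law\<close>

text \<open>The logarithm of output density over likelihood of the sent symbol, when that symbol has
  prior \<open>q\<close> and \<open>t\<close> is half the log-likelihood ratio in its favour. Its
  negative is the information density in bits.\<close>

definition mixture_loss :: "real \<Rightarrow> real \<Rightarrow> real" where
  "mixture_loss q t = log 2 (q + (1 - q) * exp (- 2 * t))"

lemma mixture_pos: "q \<in> {0..1} \<Longrightarrow> 0 < q + (1 - q) * exp (x::real)"
  by (cases "q = 0") (auto intro!: add_pos_nonneg)

text \<open>The argument of the logarithm is an average of 1 and exp (- 2 t). The resulting linear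
  growth is integrable against the exponential tails of \<open>llr_density\<close>.\<close>

lemma abs_mixture_loss_le:
  assumes "q \<in> {0..1}"
  shows "\<bar>mixture_loss q t\<bar> \<le> 2 / ln 2 * \<bar>t\<bar>"
proof -
  have e: "exp (- 2 * \<bar>t\<bar>) \<le> exp (- 2 * t)" "exp (- 2 * t) \<le> exp (2 * \<bar>t\<bar>)" "exp (- 2 * \<bar>t\<bar>) \<le> 1" "1 \<le> exp (2 * \<bar>t\<bar>)"
    by auto
  have "q * exp (- 2 * \<bar>t\<bar>) + (1 - q) * exp (- 2 * \<bar>t\<bar>) \<le> q * 1 + (1 - q) * exp (- 2 * t)"
    "q * 1 + (1 - q) * exp (- 2 * t) \<le> q * exp (2 * \<bar>t\<bar>) + (1 - q) * exp (2 * \<bar>t\<bar>)"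
    using assms e by (intro add_mono mult_left_mono; simp)+
  then have m: "exp (- 2 * \<bar>t\<bar>) \<le> q + (1 - q) * exp (- 2 * t)" "q + (1 - q) * exp (- 2 * t) \<le> exp (2 * \<bar>t\<bar>)"
    by (simp_all add: algebra_simps)
  have "0 < q + (1 - q) * exp (- 2 * t)" using m(1) exp_gt_zero[of "- 2 * \<bar>t\<bar>"] by linarith
  then have "ln (exp (- 2 * \<bar>t\<bar>)) \<le> ln (q + (1 - q) * exp (- 2 * t))"
    "ln (q + (1 - q) * exp (- 2 * t)) \<le> ln (exp (2 * \<bar>t\<bar>))"
    using m by (subst ln_le_cancel_iff; simp)+
  then have "\<bar>ln (q + (1 - q) * exp (- 2 * t))\<bar> \<le> 2 * \<bar>t\<bar>" by simp
  then show ?thesis by (simp add: mixture_loss_def log_def divide_right_mono)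
qed

lemma mixture_loss_measurable [measurable]: "mixture_loss q \<in> borel_measurable borel"
  unfolding mixture_loss_def by measurable

lemma lborel_integrable_reflect:
  fixes f :: "real \<Rightarrow> real"
  assumes "integrable lborel f"
  shows "integrable lborel (\<lambda>t. f (- t))" "(LINT t|lborel. f (- t)) = (LINT t|lborel. f t)"
  using lborel_integrable_real_affine[OF assms, of "-1" 0] lborel_integral_real_affine[of "-1" f 0] by simp_all

lemma integrable_even_extension:
  fixes g :: "real \<Rightarrow> real"
  assumes [measurable]: "g \<in> borel_measurable borel" and g: "set_integrable lborel {0<..} g"
  shows "integrable lborel (\<lambda>t. g \<bar>t\<bar>)"
proof -
  note i = g[unfolded set_integrable_def]
  have "integrable lborel (\<lambda>t. indicator {0<..} t *\<^sub>R g t + indicator {0<..} (- t) *\<^sub>R g (- t))"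
    using i lborel_integrable_reflect(1)[OF i] by (rule Bochner_Integration.integrable_add)
  moreover have "AE t in lborel. indicator {0<..} t *\<^sub>R g t + indicator {0<..} (- t) *\<^sub>R g (- t) = g \<bar>t\<bar>"
    using AE_lborel_singleton[of "0::real"] by eventually_elim (auto simp: indicator_def)
  ultimately show ?thesis
    by (subst (asm) integrable_cong_AE[where g="\<lambda>t. g \<bar>t\<bar>"]) auto
qed

lemma lborel_integral_fold:
  fixes f :: "real \<Rightarrow> real"
  assumes f: "integrable lborel f"
  shows "(LINT t|lborel. f t) = (LINT t:{0<..}|lborel. f t + f (- t))"
proof -
  have i: "integrable lborel (\<lambda>t. indicator {0<..} t *\<^sub>R f t)" "integrable lborel (\<lambda>t. indicator {0<..} (- t) *\<^sub>R f t)"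
  proof -
    have "(\<lambda>t. indicator {0<..} (- t) *\<^sub>R f t) = (\<lambda>t. indicator {..<0} t *\<^sub>R f t)" by (auto simp: indicator_def)
    then show "integrable lborel (\<lambda>t. indicator {0<..} t *\<^sub>R f t)" "integrable lborel (\<lambda>t. indicator {0<..} (- t) *\<^sub>R f t)"
      using integrable_mult_indicator[OF _ f, of "{0<..}"] integrable_mult_indicator[OF _ f, of "{..<0}"] by simp_all
  qed
  have "(LINT t|lborel. f t) = (LINT t|lborel. indicator {0<..} t *\<^sub>R f t + indicator {0<..} (- t) *\<^sub>R f t)"
  proof (rule integral_cong_AE)
    show "AE t in lborel. f t = indicator {0<..} t *\<^sub>R f t + indicator {0<..} (- t) *\<^sub>R f t"
      using AE_lborel_singleton[of "0::real"] by eventually_elim (auto simp: indicator_def)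
  qed (use f i in auto)
  also have "\<dots> = (LINT t|lborel. indicator {0<..} t *\<^sub>R f t) + (LINT t|lborel. indicator {0<..} (- t) *\<^sub>R f t)"
    using i by (rule Bochner_Integration.integral_add)
  also have "(LINT t|lborel. indicator {0<..} (- t) *\<^sub>R f t) = (LINT t|lborel. indicator {0<..} t *\<^sub>R f (- t))"
    using lborel_integrable_reflect(2)[OF i(2)] by simp
  also have "(LINT t|lborel. indicator {0<..} t *\<^sub>R f t) + (LINT t|lborel. indicator {0<..} t *\<^sub>R f (- t))
    = (LINT t:{0<..}|lborel. f t + f (- t))"
    unfolding set_lebesgue_integral_def scaleR_add_right
    using i(1) lborel_integrable_reflect(1)[OF i(2)] by (subst Bochner_Integration.integral_add) simp_all
  finally show ?thesis .
qed

lemma integrable_llr_density_mixture_loss: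
  assumes s: "1 < s" and q: "q \<in> {0..1}"
  shows "integrable lborel (\<lambda>t. llr_density s t * mixture_loss q t)"
proof (rule Bochner_Integration.integrable_bound)
  let ?c = "(s\<^sup>2 - 1) / (2 * s) * (2 / ln 2)"
  have c: "0 \<le> (s\<^sup>2 - 1) / (2 * s)" using s by simp
  show "integrable lborel (\<lambda>t. ?c * (\<bar>t\<bar> * exp (- (s - 1) * \<bar>t\<bar>)))"
    using s by (intro integrable_mult_right integrable_even_extension[of "\<lambda>t. t * exp (- (s - 1) * t)"]
        set_integrable_power_exp) auto
  show "AE t in lborel. norm (llr_density s t * mixture_loss q t) \<le> norm (?c * (\<bar>t\<bar> * exp (- (s - 1) * \<bar>t\<bar>)))"
  proof (rule AE_I2)
    fix t
    have "t - s * \<bar>t\<bar> \<le> - (s - 1) * \<bar>t\<bar>" by (simp add: algebra_simps)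
    then have "llr_density s t \<le> (s\<^sup>2 - 1) / (2 * s) * exp (- (s - 1) * \<bar>t\<bar>)"
      unfolding llr_density_def using c by (intro mult_left_mono) simp_all
    moreover have "0 \<le> llr_density s t" unfolding llr_density_def using c by (rule mult_nonneg_nonneg) simp
    ultimately have "\<bar>llr_density s t * mixture_loss q t\<bar>
      \<le> ((s\<^sup>2 - 1) / (2 * s) * exp (- (s - 1) * \<bar>t\<bar>)) * (2 / ln 2 * \<bar>t\<bar>)"
      unfolding abs_mult using abs_mixture_loss_le[OF q, of t] c by (intro mult_mono) simp_all
    also have "\<dots> = ?c * (\<bar>t\<bar> * exp (- (s - 1) * \<bar>t\<bar>))" by (simp only: mult_ac)
    also have "\<dots> \<le> norm (?c * (\<bar>t\<bar> * exp (- (s - 1) * \<bar>t\<bar>)))" unfolding real_norm_def by (rule abs_ge_self)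
    finally show "norm (llr_density s t * mixture_loss q t) \<le> norm (?c * (\<bar>t\<bar> * exp (- (s - 1) * \<bar>t\<bar>)))"
      unfolding real_norm_def .
  qed
qed auto

lemma llr_density_fold:
  fixes s :: real
  assumes p: "p \<in> {0..1}" and t: "0 < t"
  defines "h \<equiv> \<lambda>t. llr_density s t * (p * mixture_loss p t + (1 - p) * mixture_loss (1 - p) t)"
  shows "h t + h (- t) = - ((s\<^sup>2 - 1) / (2 * s) / ln 2) * (exp (- s * t) * info_kernel p t)"
proof -
  define A B where "A = tilt p t" and "B = tilt (1 - p) t"
  have pos: "0 < A" "0 < B" using tilt_pos p by (auto simp: A_def B_def)
  have ee: "exp t * exp (- t) = 1" by (simp add: exp_minus)
  have e2: "exp (- 2 * t) = exp (- t) * exp (- t)" "exp (2 * t) = exp t * exp t" by (simp_all flip: exp_add)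
  \<comment> \<open>Each of the four logarithms becomes \<open>ln A\<close> or \<open>ln B\<close>
    shifted by \<open>t\<close> or \<open>- t\<close>; the shifts produce the term t (exp t - exp (-
    t)) of the kernel.\<close>
  have "p + (1 - p) * exp (- 2 * t) = A * exp (- t)" "(1 - p) + p * exp (- 2 * t) = B * exp (- t)"
    "p + (1 - p) * exp (2 * t) = B * exp t" "(1 - p) + p * exp (2 * t) = A * exp t"
    unfolding A_def B_def tilt_def e2 using ee by algebra+
  then have m: "ln 2 * mixture_loss p t = ln A - t" "ln 2 * mixture_loss (1 - p) t = ln B - t"
    "ln 2 * mixture_loss p (- t) = ln B + t" "ln 2 * mixture_loss (1 - p) (- t) = ln A + t"
    using pos by (simp_all add: mixture_loss_def log_def ln_mult)
  have d: "llr_density s t = (s\<^sup>2 - 1) / (2 * s) * (exp (- s * t) * exp t)"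
    "llr_density s (- t) = (s\<^sup>2 - 1) / (2 * s) * (exp (- s * t) * exp (- t))"
    using t by (simp_all add: llr_density_def flip: exp_add)
  have "ln 2 * (h t + h (- t)) = (s\<^sup>2 - 1) / (2 * s) * exp (- s * t) *
      (exp t * (p * (ln 2 * mixture_loss p t) + (1 - p) * (ln 2 * mixture_loss (1 - p) t))
      + exp (- t) * (p * (ln 2 * mixture_loss p (- t)) + (1 - p) * (ln 2 * mixture_loss (1 - p) (- t))))"
    unfolding h_def d by (simp only: distrib_left distrib_right mult_ac)
  also have "\<dots> = (s\<^sup>2 - 1) / (2 * s) * exp (- s * t) * (- info_kernel p t)"
    unfolding m info_kernel_def A_def[symmetric] B_def[symmetric]
    by (rule arg_cong[where f="(*) _"]) (simp add: A_def B_def tilt_def algebra_simps)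
  also have "\<dots> = ln 2 * (- ((s\<^sup>2 - 1) / (2 * s) / ln 2) * (exp (- s * t) * info_kernel p t))" by simp
  finally show ?thesis by (rule mult_left_cancel[THEN iffD1, rotated]) simp
qed

lemma expected_mixture_loss:
  assumes s: "1 < s" and p: "p \<in> {0..1}"
  shows "p * (LINT t|lborel. llr_density s t * mixture_loss p t)
    + (1 - p) * (LINT t|lborel. llr_density s t * mixture_loss (1 - p) t) = - info_transform s p / ln 2"
proof -
  have i: "integrable lborel (\<lambda>t. llr_density s t * mixture_loss p t)"
    "integrable lborel (\<lambda>t. llr_density s t * mixture_loss (1 - p) t)"
    using p by (auto intro!: integrable_llr_density_mixture_loss s)
  let ?h = "\<lambda>t. llr_density s t * (p * mixture_loss p t + (1 - p) * mixture_loss (1 - p) t)"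
  have h: "?h = (\<lambda>t. p * (llr_density s t * mixture_loss p t) + (1 - p) * (llr_density s t * mixture_loss (1 - p) t))"
    by (simp add: algebra_simps)
  have "(LINT t|lborel. ?h t) = p * (LINT t|lborel. llr_density s t * mixture_loss p t)
    + (1 - p) * (LINT t|lborel. llr_density s t * mixture_loss (1 - p) t)"
    unfolding h using i by (subst Bochner_Integration.integral_add) auto
  moreover have "(LINT t|lborel. ?h t) = (LINT t:{0<..}|lborel. ?h t + ?h (- t))"
    by (rule lborel_integral_fold) (unfold h, use i in simp)
  moreover have "\<dots> = (LINT t:{0<..}|lborel. - ((s\<^sup>2 - 1) / (2 * s) / ln 2) * (exp (- s * t) * info_kernel p t))"
    by (rule set_lebesgue_integral_cong) (use llr_density_fold[OF p] in auto)
  moreover have "\<dots> = - info_transform s p / ln 2"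
    unfolding info_transform_def by (subst set_integral_mult_right) simp
  ultimately show ?thesis by simp
qed

section \<open>Mutual information of the channels\<close>

text \<open>By \<open>joint\<close>, \<open>f\<close> is the density of the joint law against the
  product of the marginals; the independent copy \<omega>' expresses that product through
  \<open>M\<close> itself, so no marginal has to be identified beforehand. The divergence formula
  then gives the expected logarithm.\<close>

lemma (in prob_space) mutual_information_eq_expectation:
  fixes f :: "'b \<times> 'c \<Rightarrow> real"
  assumes [measurable]: "random_variable S X" "random_variable T Y" "f \<in> borel_measurable (S \<Otimes>\<^sub>M T)"
    and nonneg: "\<And>x. 0 \<le> f x" and b: "1 < b"
    and joint: "\<And>A. A \<in> sets (S \<Otimes>\<^sub>M T) \<Longrightarrow> (\<integral>\<^sup>+\<omega>. indicator A (X \<omega>, Y \<omega>) \<partial>M)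
      = (\<integral>\<^sup>+\<omega>. \<integral>\<^sup>+\<omega>'. ennreal (f (X \<omega>, Y \<omega>')) * indicator A (X \<omega>, Y \<omega>') \<partial>M \<partial>M)"
  shows "mutual_information b S T X Y = (\<integral>\<omega>. log b (f (X \<omega>, Y \<omega>)) \<partial>M)"
proof -
  let ?P = "distr M S X \<Otimes>\<^sub>M distr M T Y"
  interpret X: prob_space "distr M S X" by (rule prob_space_distr) simp
  interpret Y: prob_space "distr M T Y" by (rule prob_space_distr) simp
  interpret XY: pair_prob_space "distr M S X" "distr M T Y" ..
  have [measurable_cong]: "sets ?P = sets (S \<Otimes>\<^sub>M T)" by (intro sets_pair_measure_cong) simp_all
  have eq: "distr M (S \<Otimes>\<^sub>M T) (\<lambda>\<omega>. (X \<omega>, Y \<omega>)) = density ?P f"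
  proof (rule measure_eqI)
    fix A assume "A \<in> sets (distr M (S \<Otimes>\<^sub>M T) (\<lambda>\<omega>. (X \<omega>, Y \<omega>)))"
    then have A[measurable]: "A \<in> sets (S \<Otimes>\<^sub>M T)" by simp
    have "emeasure (distr M (S \<Otimes>\<^sub>M T) (\<lambda>\<omega>. (X \<omega>, Y \<omega>))) A
        = (\<integral>\<^sup>+x. indicator A x \<partial>distr M (S \<Otimes>\<^sub>M T) (\<lambda>\<omega>. (X \<omega>, Y \<omega>)))" by simp
    also have "\<dots> = (\<integral>\<^sup>+\<omega>. indicator A (X \<omega>, Y \<omega>) \<partial>M)"
      by (subst nn_integral_distr) auto
    also have "\<dots> = (\<integral>\<^sup>+x. \<integral>\<^sup>+y. ennreal (f (x, y)) * indicator A (x, y) \<partial>distr M T Y \<partial>distr M S X)"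
      unfolding joint[OF A] by (subst nn_integral_distr, simp, measurable)
        (intro nn_integral_cong, subst nn_integral_distr, auto)
    also have "\<dots> = emeasure (density ?P f) A"
      by (subst Y.nn_integral_fst) (auto simp: emeasure_density)
    finally show "emeasure (distr M (S \<Otimes>\<^sub>M T) (\<lambda>\<omega>. (X \<omega>, Y \<omega>))) A = emeasure (density ?P f) A" .
  qed (simp cong: sets_pair_measure_cong)
  have "mutual_information b S T X Y = (\<integral>x. f x * log b (f x) \<partial>?P)"
    unfolding mutual_information_def eq using nonneg b by (intro XY.KL_density) auto
  also have "\<dots> = (\<integral>x. log b (f x) \<partial>density ?P f)"
    using nonneg by (subst integral_density) auto
  also have "\<dots> = (\<integral>\<omega>. log b (f (X \<omega>, Y \<omega>)) \<partial>M)"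
    unfolding eq[symmetric] by (subst integral_distr) auto
  finally show ?thesis .
qed

definition output_density :: "real \<Rightarrow> real \<Rightarrow> real \<Rightarrow> complex \<Rightarrow> complex \<Rightarrow> real" where
  "output_density P \<sigma> p a y = p * complex_gaussian_density (\<sigma>\<^sup>2) (y - a * bpsk_input P True)
    + (1 - p) * complex_gaussian_density (\<sigma>\<^sup>2) (y - a * bpsk_input P False)"

lemma output_density_measurable [measurable]:
  "(\<lambda>(a, y). output_density P \<sigma> p a y) \<in> borel_measurable (borel \<Otimes>\<^sub>M borel)"
  unfolding output_density_def by measurable

text \<open>The part of the sensing information density that does not involve \<open>p\<close>: the law of the output is
  Gaussian of variance \<open>P \<Omega> + \<sigma>\<^sup>2\<close> for every \<open>p\<close>, since the law of the coefficient is symmetric.\<close>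

definition output_gain :: "real \<Rightarrow> real \<Rightarrow> real \<Rightarrow> complex \<Rightarrow> complex \<Rightarrow> real" where
  "output_gain P \<Omega> \<sigma> a n = log 2 (complex_gaussian_density (\<sigma>\<^sup>2) n
    / complex_gaussian_density (P * \<Omega> + \<sigma>\<^sup>2) (a * bpsk_input P True + n))"

abbreviation coeff_noise :: "real \<Rightarrow> real \<Rightarrow> (complex \<times> complex) measure" where
  "coeff_noise \<Omega> \<sigma> \<equiv> complex_gaussian \<Omega> \<Otimes>\<^sub>M complex_gaussian (\<sigma>\<^sup>2)"

lemma nn_integral_channel_space:
  assumes "0 < \<Omega>" "0 < \<sigma>" "p \<in> {0..1}" and g[measurable]: "g \<in> borel_measurable (channel_space \<Omega> \<sigma> p)"
  shows "(\<integral>\<^sup>+\<omega>. g \<omega> \<partial>channel_space \<Omega> \<sigma> p)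
    = ennreal p * (\<integral>\<^sup>+a. \<integral>\<^sup>+n. g (True, a, n) \<partial>complex_gaussian (\<sigma>\<^sup>2) \<partial>complex_gaussian \<Omega>)
    + ennreal (1 - p) * (\<integral>\<^sup>+a. \<integral>\<^sup>+n. g (False, a, n) \<partial>complex_gaussian (\<sigma>\<^sup>2) \<partial>complex_gaussian \<Omega>)"
proof -
  interpret A: prob_space "complex_gaussian \<Omega>" using assms by (intro prob_space_complex_gaussian) simp
  interpret N: prob_space "complex_gaussian (\<sigma>\<^sup>2)" using assms by (intro prob_space_complex_gaussian) simp
  interpret AN: pair_prob_space "complex_gaussian \<Omega>" "complex_gaussian (\<sigma>\<^sup>2)" ..
  have g'[measurable]: "g \<in> borel_measurable (measure_pmf (bernoulli_pmf p) \<Otimes>\<^sub>M (coeff_noise \<Omega> \<sigma>))"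
    using g unfolding channel_space_def .
  have "(\<integral>\<^sup>+\<omega>. g \<omega> \<partial>channel_space \<Omega> \<sigma> p)
    = (\<integral>\<^sup>+b. \<integral>\<^sup>+an. g (b, an) \<partial>(coeff_noise \<Omega> \<sigma>) \<partial>measure_pmf (bernoulli_pmf p))"
    unfolding channel_space_def by (rule AN.nn_integral_fst[symmetric]) simp
  also have "\<dots> = (\<integral>\<^sup>+b. \<integral>\<^sup>+a. \<integral>\<^sup>+n. g (b, a, n) \<partial>complex_gaussian (\<sigma>\<^sup>2) \<partial>complex_gaussian \<Omega> \<partial>measure_pmf (bernoulli_pmf p))"
    by (intro nn_integral_cong N.nn_integral_fst[symmetric]) simp
  finally show ?thesis using assms(3) by (simp add: mult.commute)
qed

lemma integral_channel_space:
  fixes g :: "_ \<Rightarrow> real"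
  assumes "0 < \<Omega>" "0 < \<sigma>" "p \<in> {0..1}" and g[measurable]: "g \<in> borel_measurable (channel_space \<Omega> \<sigma> p)"
    and int: "\<And>b. integrable (coeff_noise \<Omega> \<sigma>) (\<lambda>an. g (b, an))"
  shows "(\<integral>\<omega>. g \<omega> \<partial>channel_space \<Omega> \<sigma> p)
    = p * (\<integral>an. g (True, an) \<partial>(coeff_noise \<Omega> \<sigma>))
    + (1 - p) * (\<integral>an. g (False, an) \<partial>(coeff_noise \<Omega> \<sigma>))"
proof -
  interpret A: prob_space "complex_gaussian \<Omega>" using assms by (intro prob_space_complex_gaussian) simp
  interpret N: prob_space "complex_gaussian (\<sigma>\<^sup>2)" using assms by (intro prob_space_complex_gaussian) simp
  interpret AN: pair_prob_space "complex_gaussian \<Omega>" "complex_gaussian (\<sigma>\<^sup>2)" ..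
  interpret B: pair_prob_space "measure_pmf (bernoulli_pmf p)" "coeff_noise \<Omega> \<sigma>" ..
  have g'[measurable]: "g \<in> borel_measurable (measure_pmf (bernoulli_pmf p) \<Otimes>\<^sub>M (coeff_noise \<Omega> \<sigma>))"
    using g unfolding channel_space_def .
  have "integrable (measure_pmf (bernoulli_pmf p) \<Otimes>\<^sub>M (coeff_noise \<Omega> \<sigma>)) g"
    using int by (intro B.Fubini_integrable integrable_measure_pmf_finite) auto
  from B.integral_fst'[OF this] show ?thesis
    using assms(3) by (simp add: channel_space_def mult.commute)
qed

context
  fixes P \<Omega> \<sigma> p :: real
  assumes pos: "0 < P" "0 < \<Omega>" "0 < \<sigma>" and p: "p \<in> {0..1}"
begin

interpretation A: prob_space "complex_gaussian \<Omega>" using pos by (intro prob_space_complex_gaussian) simp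
interpretation N: prob_space "complex_gaussian (\<sigma>\<^sup>2)" using pos by (intro prob_space_complex_gaussian) simp
interpretation AN: pair_prob_space "complex_gaussian \<Omega>" "complex_gaussian (\<sigma>\<^sup>2)" ..
interpretation M: prob_space "channel_space \<Omega> \<sigma> p" using pos(2,3) by (rule prob_space_channel_space)

lemma output_density_pos: "0 < output_density P \<sigma> p a y"
proof -
  have "0 < complex_gaussian_density (\<sigma>\<^sup>2) z" for z using pos by (intro complex_gaussian_density_pos) simp
  then show ?thesis unfolding output_density_def
    using p by (cases "p = 0") (auto intro!: add_pos_nonneg simp: less_imp_le)
qed

lemma nn_integral_channel_output:
  assumes [measurable]: "E \<in> borel_measurable (borel \<Otimes>\<^sub>M borel)"
  shows "(\<integral>\<^sup>+\<omega>. E (channel_coeff \<omega>, channel_output P \<omega>) \<partial>channel_space \<Omega> \<sigma> p)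
    = (\<integral>\<^sup>+a. \<integral>\<^sup>+y. ennreal (output_density P \<sigma> p a y) * E (a, y) \<partial>lborel \<partial>complex_gaussian \<Omega>)"
proof -
  have *: "(\<integral>\<^sup>+n. E (a, a * x + n) \<partial>complex_gaussian (\<sigma>\<^sup>2))
    = (\<integral>\<^sup>+y. ennreal (complex_gaussian_density (\<sigma>\<^sup>2) (y - a * x)) * E (a, y) \<partial>lborel)" for a x
    using pos by (intro nn_integral_complex_gaussian_translate) auto
  have nn: "0 \<le> complex_gaussian_density (\<sigma>\<^sup>2) z" for z using pos by (simp add: complex_gaussian_density_pos less_imp_le)
  have "(\<integral>\<^sup>+\<omega>. E (channel_coeff \<omega>, channel_output P \<omega>) \<partial>channel_space \<Omega> \<sigma> p)
    = (\<integral>\<^sup>+a. ennreal p * (\<integral>\<^sup>+y. ennreal (complex_gaussian_density (\<sigma>\<^sup>2) (y - a * bpsk_input P True)) * E (a, y) \<partial>lborel)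
      + ennreal (1 - p) * (\<integral>\<^sup>+y. ennreal (complex_gaussian_density (\<sigma>\<^sup>2) (y - a * bpsk_input P False)) * E (a, y) \<partial>lborel)
      \<partial>complex_gaussian \<Omega>)"
    using pos p by (subst nn_integral_channel_space)
      (auto simp: channel_coeff_def channel_output_def * nn_integral_add nn_integral_cmult)
  also have "\<dots> = (\<integral>\<^sup>+a. \<integral>\<^sup>+y. ennreal (output_density P \<sigma> p a y) * E (a, y) \<partial>lborel \<partial>complex_gaussian \<Omega>)"
  proof (rule nn_integral_cong)
    fix a
    have "ennreal p * (ennreal (complex_gaussian_density (\<sigma>\<^sup>2) (y - a * bpsk_input P True)) * E (a, y))
        + ennreal (1 - p) * (ennreal (complex_gaussian_density (\<sigma>\<^sup>2) (y - a * bpsk_input P False)) * E (a, y))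
        = ennreal (output_density P \<sigma> p a y) * E (a, y)" for y
      using p nn by (simp add: output_density_def ennreal_plus ennreal_mult distrib_right mult.assoc)
    then show "ennreal p * (\<integral>\<^sup>+y. ennreal (complex_gaussian_density (\<sigma>\<^sup>2) (y - a * bpsk_input P True)) * E (a, y) \<partial>lborel)
      + ennreal (1 - p) * (\<integral>\<^sup>+y. ennreal (complex_gaussian_density (\<sigma>\<^sup>2) (y - a * bpsk_input P False)) * E (a, y) \<partial>lborel)
      = (\<integral>\<^sup>+y. ennreal (output_density P \<sigma> p a y) * E (a, y) \<partial>lborel)"
      by (simp add: nn_integral_cmult[symmetric] nn_integral_add[symmetric])
  qed
  finally show ?thesis .
qed

text \<open>The library's conditional mutual information is I(X; (Y, H)) - I(X; H). The second term
  is zero by independence, and the first has as density the likelihood divided by the output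
  mixture.\<close>

lemma comm_rate_eq_expectation:
  "comm_rate P \<Omega> \<sigma> p = (\<integral>\<omega>. log 2 (complex_gaussian_density (\<sigma>\<^sup>2)
      (channel_output P \<omega> - channel_coeff \<omega> * channel_input P \<omega>)
      / output_density P \<sigma> p (channel_coeff \<omega>) (channel_output P \<omega>)) \<partial>channel_space \<Omega> \<sigma> p)"
proof -
  define f where "f = (\<lambda>(x, y, a). complex_gaussian_density (\<sigma>\<^sup>2) (y - a * x) / output_density P \<sigma> p a y)"
  have [measurable]: "f \<in> borel_measurable (borel \<Otimes>\<^sub>M (borel \<Otimes>\<^sub>M borel))" unfolding f_def by measurable
  have nn: "0 < complex_gaussian_density (\<sigma>\<^sup>2) z" for z using pos by (simp add: complex_gaussian_density_pos)
  have "M.mutual_information 2 borel (borel \<Otimes>\<^sub>M borel) (channel_input P) (\<lambda>\<omega>. (channel_output P \<omega>, channel_coeff \<omega>))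
    = (\<integral>\<omega>. log 2 (f (channel_input P \<omega>, channel_output P \<omega>, channel_coeff \<omega>)) \<partial>channel_space \<Omega> \<sigma> p)"
  proof (rule M.mutual_information_eq_expectation)
    show "0 \<le> f x" for x
      using nn output_density_pos by (auto simp: f_def less_imp_le split: prod.split)
    fix A :: "(complex \<times> complex \<times> complex) set" assume [measurable]: "A \<in> sets (borel \<Otimes>\<^sub>M (borel \<Otimes>\<^sub>M borel))"
    \<comment> \<open>The conditional probability that the triple lies in \<open>A\<close> when the
      input is \<open>x\<close>; both sides of the density condition are its average over the
      input.\<close>
    define I where "I x = (\<integral>\<^sup>+a. \<integral>\<^sup>+y. ennreal (complex_gaussian_density (\<sigma>\<^sup>2) (y - a * x)) * indicator A (x, y, a)
      \<partial>lborel \<partial>complex_gaussian \<Omega>)" for x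
    have [measurable]: "I \<in> borel_measurable borel" unfolding I_def by measurable
    have "(\<integral>\<^sup>+n. indicator A (x, a * x + n, a) \<partial>complex_gaussian (\<sigma>\<^sup>2))
      = (\<integral>\<^sup>+y. ennreal (complex_gaussian_density (\<sigma>\<^sup>2) (y - a * x)) * indicator A (x, y, a) \<partial>lborel)" for a x
      using pos by (intro nn_integral_complex_gaussian_translate) auto
    then have "(\<integral>\<^sup>+\<omega>. indicator A (channel_input P \<omega>, channel_output P \<omega>, channel_coeff \<omega>) \<partial>channel_space \<Omega> \<sigma> p)
      = ennreal p * I (bpsk_input P True) + ennreal (1 - p) * I (bpsk_input P False)"
      using pos p by (subst nn_integral_channel_space)
        (auto simp: I_def channel_input_def channel_output_def channel_coeff_def)
    also have "\<dots> = (\<integral>\<^sup>+\<omega>. I (channel_input P \<omega>) \<partial>channel_space \<Omega> \<sigma> p)"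
      using pos p by (subst nn_integral_channel_space)
        (auto simp: channel_input_def A.emeasure_space_1[simplified] N.emeasure_space_1[simplified])
    also note chain = calculation
    have I_eq: "I x = (\<integral>\<^sup>+\<omega>. ennreal (f (x, channel_output P \<omega>, channel_coeff \<omega>))
      * indicator A (x, channel_output P \<omega>, channel_coeff \<omega>) \<partial>channel_space \<Omega> \<sigma> p)" for x
    proof -
      have "ennreal (output_density P \<sigma> p a y) * (ennreal (f (x, y, a)) * indicator A (x, y, a))
        = ennreal (complex_gaussian_density (\<sigma>\<^sup>2) (y - a * x)) * indicator A (x, y, a)" for a y
        using output_density_pos[of a y] nn[of "y - a * x"]
        by (simp add: f_def mult.assoc[symmetric] ennreal_mult'[symmetric])
      then show ?thesis
        using nn_integral_channel_output[of "\<lambda>(a, y). ennreal (f (x, y, a)) * indicator A (x, y, a)"]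
        by (simp add: I_def)
    qed
    show "(\<integral>\<^sup>+\<omega>. indicator A (channel_input P \<omega>, channel_output P \<omega>, channel_coeff \<omega>) \<partial>channel_space \<Omega> \<sigma> p)
      = (\<integral>\<^sup>+\<omega>. \<integral>\<^sup>+\<omega>'. ennreal (f (channel_input P \<omega>, channel_output P \<omega>', channel_coeff \<omega>'))
        * indicator A (channel_input P \<omega>, channel_output P \<omega>', channel_coeff \<omega>')
        \<partial>channel_space \<Omega> \<sigma> p \<partial>channel_space \<Omega> \<sigma> p)"
      unfolding chain I_eq by simp
  qed auto
  \<comment> \<open>Input and coefficient are independent, so the density of their joint law is 1
    and the logarithm vanishes.\<close>
  moreover have "M.mutual_information 2 borel borel (channel_input P) channel_coeff
    = (\<integral>\<omega>. log 2 1 \<partial>channel_space \<Omega> \<sigma> p)"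
  proof (rule M.mutual_information_eq_expectation[where f="\<lambda>_. 1"])
    fix A :: "(complex \<times> complex) set" assume [measurable]: "A \<in> sets (borel \<Otimes>\<^sub>M borel)"
    define I where "I x = (\<integral>\<^sup>+a. indicator A (x, a) \<partial>complex_gaussian \<Omega>)" for x
    have [measurable]: "I \<in> borel_measurable borel" unfolding I_def by measurable
    have "(\<integral>\<^sup>+\<omega>. indicator A (channel_input P \<omega>, channel_coeff \<omega>) \<partial>channel_space \<Omega> \<sigma> p)
      = ennreal p * I (bpsk_input P True) + ennreal (1 - p) * I (bpsk_input P False)"
      using pos p by (subst nn_integral_channel_space)
        (auto simp: I_def channel_input_def channel_coeff_def N.emeasure_space_1[simplified])
    also have "\<dots> = (\<integral>\<^sup>+\<omega>. I (channel_input P \<omega>) \<partial>channel_space \<Omega> \<sigma> p)"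
      using pos p by (subst nn_integral_channel_space)
        (auto simp: channel_input_def A.emeasure_space_1[simplified] N.emeasure_space_1[simplified])
    also note chain = calculation
    have I_eq: "I x = (\<integral>\<^sup>+\<omega>. indicator A (x, channel_coeff \<omega>) \<partial>channel_space \<Omega> \<sigma> p)" for x
      using pos p by (subst nn_integral_channel_space)
        (auto simp: I_def channel_coeff_def N.emeasure_space_1[simplified] distrib_right[symmetric] simp flip: ennreal_plus)
    show "(\<integral>\<^sup>+\<omega>. indicator A (channel_input P \<omega>, channel_coeff \<omega>) \<partial>channel_space \<Omega> \<sigma> p)
      = (\<integral>\<^sup>+\<omega>. \<integral>\<^sup>+\<omega>'. ennreal 1 * indicator A (channel_input P \<omega>, channel_coeff \<omega>')
        \<partial>channel_space \<Omega> \<sigma> p \<partial>channel_space \<Omega> \<sigma> p)"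
      unfolding chain I_eq by simp
  qed auto
  ultimately show ?thesis
    by (simp add: comm_rate_def M.conditional_mutual_information_def f_def)
qed

lemma sensing_rate_eq_expectation:
  "sensing_rate P \<Omega> \<sigma> p = (\<integral>\<omega>. log 2 (output_density P \<sigma> p (channel_coeff \<omega>) (channel_output P \<omega>)
      / complex_gaussian_density (P * \<Omega> + \<sigma>\<^sup>2) (channel_output P \<omega>)) \<partial>channel_space \<Omega> \<sigma> p)"
proof -
  define v where "v = P * \<Omega> + \<sigma>\<^sup>2"
  define f where "f = (\<lambda>(a, y). output_density P \<sigma> p a y / complex_gaussian_density v y)"
  have [measurable]: "f \<in> borel_measurable (borel \<Otimes>\<^sub>M borel)" unfolding f_def by measurable
  have v: "0 < v" using pos by (simp add: v_def add_pos_pos)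
  have nn: "0 < complex_gaussian_density v z" for z using v by (simp add: complex_gaussian_density_pos)
  \<comment> \<open>Either symbol multiplies the coefficient by a real number of square
    \<open>P\<close>, so both conditional output laws are the same Gaussian and the prior drops
    out.\<close>
  have law_output: "(\<integral>\<^sup>+\<omega>. E (channel_output P \<omega>) \<partial>channel_space \<Omega> \<sigma> p)
    = (\<integral>\<^sup>+y. ennreal (complex_gaussian_density v y) * E y \<partial>lborel)"
    if [measurable]: "E \<in> borel_measurable borel" for E
  proof -
    have "(\<integral>\<^sup>+a. \<integral>\<^sup>+n. E (a * bpsk_input P b + n) \<partial>complex_gaussian (\<sigma>\<^sup>2) \<partial>complex_gaussian \<Omega>)
      = (\<integral>\<^sup>+y. E y \<partial>complex_gaussian v)" for b
    proof -
      have "a * bpsk_input P b = (if b then sqrt P else - sqrt P) *\<^sub>R a" for a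
        by (simp add: bpsk_input_def scaleR_conv_of_real)
      then show ?thesis
        using nn_integral_complex_gaussian_add[of \<Omega> "\<sigma>\<^sup>2" "if b then sqrt P else - sqrt P" E] pos
        by (auto simp: v_def)
    qed
    then show ?thesis
      using pos p v by (subst nn_integral_channel_space)
        (auto simp: channel_output_def nn_integral_complex_gaussian distrib_right[symmetric] simp flip: ennreal_plus)
  qed
  have "M.mutual_information 2 borel borel channel_coeff (channel_output P)
    = (\<integral>\<omega>. log 2 (f (channel_coeff \<omega>, channel_output P \<omega>)) \<partial>channel_space \<Omega> \<sigma> p)"
  proof (rule M.mutual_information_eq_expectation)
    show "0 \<le> f x" for x
      using nn output_density_pos by (auto simp: f_def less_imp_le split: prod.split)
    fix A :: "(complex \<times> complex) set" assume [measurable]: "A \<in> sets (borel \<Otimes>\<^sub>M borel)"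
    define I where "I a = (\<integral>\<^sup>+y. ennreal (output_density P \<sigma> p a y) * indicator A (a, y) \<partial>lborel)" for a
    have [measurable]: "I \<in> borel_measurable borel" unfolding I_def by measurable
    have "(\<integral>\<^sup>+\<omega>. indicator A (channel_coeff \<omega>, channel_output P \<omega>) \<partial>channel_space \<Omega> \<sigma> p)
      = (\<integral>\<^sup>+a. I a \<partial>complex_gaussian \<Omega>)"
      unfolding I_def by (rule nn_integral_channel_output) simp
    also have "\<dots> = (\<integral>\<^sup>+\<omega>. I (channel_coeff \<omega>) \<partial>channel_space \<Omega> \<sigma> p)"
      using pos p by (subst nn_integral_channel_space)
        (auto simp: channel_coeff_def N.emeasure_space_1[simplified] distrib_right[symmetric] simp flip: ennreal_plus)
    also note chain = calculation
    have I_eq: "I a = (\<integral>\<^sup>+\<omega>. ennreal (f (a, channel_output P \<omega>))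
      * indicator A (a, channel_output P \<omega>) \<partial>channel_space \<Omega> \<sigma> p)" for a
    proof -
      have "ennreal (complex_gaussian_density v y) * (ennreal (f (a, y)) * indicator A (a, y))
        = ennreal (output_density P \<sigma> p a y) * indicator A (a, y)" for y
        using output_density_pos[of a y] nn[of y]
        by (simp add: f_def mult.assoc[symmetric] ennreal_mult'[symmetric])
      then show ?thesis by (subst law_output) (simp_all add: I_def)
    qed
    show "(\<integral>\<^sup>+\<omega>. indicator A (channel_coeff \<omega>, channel_output P \<omega>) \<partial>channel_space \<Omega> \<sigma> p)
      = (\<integral>\<^sup>+\<omega>. \<integral>\<^sup>+\<omega>'. ennreal (f (channel_coeff \<omega>, channel_output P \<omega>'))
        * indicator A (channel_coeff \<omega>, channel_output P \<omega>')
        \<partial>channel_space \<Omega> \<sigma> p \<partial>channel_space \<Omega> \<sigma> p)"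
      unfolding chain I_eq by simp
  qed auto
  then show ?thesis by (simp add: sensing_rate_def f_def v_def)
qed

section \<open>Reduction of both rates to the transform\<close>

lemma distr_reflect_coeff:
  "distr (coeff_noise \<Omega> \<sigma>) (coeff_noise \<Omega> \<sigma>) (\<lambda>(a, n). (- a, n))
    = coeff_noise \<Omega> \<sigma>"
proof -
  have "distr (complex_gaussian \<Omega>) (complex_gaussian \<Omega>) uminus = complex_gaussian \<Omega>"
    using distr_uminus_complex_gaussian[OF pos(2)] by (simp cong: distr_cong)
  moreover have "distr (complex_gaussian (\<sigma>\<^sup>2)) (complex_gaussian (\<sigma>\<^sup>2)) (\<lambda>n. n) = complex_gaussian (\<sigma>\<^sup>2)"
    by (rule distr_id2) simp
  ultimately show ?thesis
    using pair_measure_distr[of uminus "complex_gaussian \<Omega>" "complex_gaussian \<Omega>" "\<lambda>n. n" "complex_gaussian (\<sigma>\<^sup>2)" "complex_gaussian (\<sigma>\<^sup>2)"]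
      N.sigma_finite_measure_axioms by simp
qed

text \<open>Sending -1 replaces \<open>a\<close> by \<open>- a\<close>; by symmetry of the
  coefficient both symbols can be evaluated with one and the same law of \<open>llr\<close>.\<close>

lemma reflect_coeff:
  fixes g :: "complex \<Rightarrow> complex \<Rightarrow> real"
  assumes g: "integrable (coeff_noise \<Omega> \<sigma>) (\<lambda>(a, n). g a n)"
  shows "integrable (coeff_noise \<Omega> \<sigma>) (\<lambda>(a, n). g (- a) n)"
    "(\<integral>(a, n). g (- a) n \<partial>coeff_noise \<Omega> \<sigma>)
      = (\<integral>(a, n). g a n \<partial>coeff_noise \<Omega> \<sigma>)"
proof -
  have [measurable]: "(\<lambda>(a, n). (- a, n)) \<in> (coeff_noise \<Omega> \<sigma>) \<rightarrow>\<^sub>M (coeff_noise \<Omega> \<sigma>)" by measurable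
  have [measurable]: "(\<lambda>(a, n). g a n) \<in> borel_measurable (coeff_noise \<Omega> \<sigma>)" using g by auto
  show "integrable (coeff_noise \<Omega> \<sigma>) (\<lambda>(a, n). g (- a) n)"
    using integrable_distr[of "\<lambda>(a, n). (- a, n)" "(coeff_noise \<Omega> \<sigma>)" "(coeff_noise \<Omega> \<sigma>)" "\<lambda>(a, n). g a n", unfolded distr_reflect_coeff] g
    by (simp add: split_beta')
  show "(\<integral>(a, n). g (- a) n \<partial>coeff_noise \<Omega> \<sigma>) = (\<integral>(a, n). g a n \<partial>coeff_noise \<Omega> \<sigma>)"
    using integral_distr[of "\<lambda>(a, n). (- a, n)" "(coeff_noise \<Omega> \<sigma>)" "(coeff_noise \<Omega> \<sigma>)" "\<lambda>(a, n). g a n", unfolded distr_reflect_coeff]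
    by (simp add: split_beta')
qed

lemma llr_transfer:
  fixes q
  assumes q: "q \<in> {0..1}"
  defines "s \<equiv> sqrt (1 + 2 / (2 * P * \<Omega> / \<sigma>\<^sup>2))"
  shows "integrable (coeff_noise \<Omega> \<sigma>) (\<lambda>(a, n). mixture_loss q (llr P \<sigma> a n))"
    "(\<integral>(a, n). mixture_loss q (llr P \<sigma> a n) \<partial>coeff_noise \<Omega> \<sigma>)
      = (LINT t|lborel. llr_density s t * mixture_loss q t)"
proof -
  have s: "1 < s" using pos by (simp add: s_def)
  have nn: "0 \<le> llr_density s t" for t using s by (simp add: llr_density_def)
  note d = distr_llr[OF pos, folded s_def]
  have "integrable (density lborel (llr_density s)) (mixture_loss q)"
    using integrable_llr_density_mixture_loss[OF s q] nn by (subst integrable_density) auto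
  then show "integrable (coeff_noise \<Omega> \<sigma>) (\<lambda>(a, n). mixture_loss q (llr P \<sigma> a n))"
    unfolding d[symmetric] by (subst (asm) integrable_distr_eq) (auto simp: split_beta')
  have "(\<integral>(a, n). mixture_loss q (llr P \<sigma> a n) \<partial>coeff_noise \<Omega> \<sigma>) = (\<integral>t. mixture_loss q t \<partial>density lborel (llr_density s))"
    unfolding d[symmetric] by (subst integral_distr) (auto simp: split_beta')
  also have "\<dots> = (LINT t|lborel. llr_density s t * mixture_loss q t)"
    using nn by (subst integral_density) auto
  finally show "(\<integral>(a, n). mixture_loss q (llr P \<sigma> a n) \<partial>coeff_noise \<Omega> \<sigma>) = (LINT t|lborel. llr_density s t * mixture_loss q t)" .
qed

text \<open>The shift by 2 sqrt P a turns the residual for the sent symbol +1 into the residual for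
  -1. The factor 2 in the exponent is why \<open>llr\<close> is half of the log-likelihood
  ratio.\<close>

lemma complex_gaussian_density_shift:
  "complex_gaussian_density (\<sigma>\<^sup>2) (n + (2 * sqrt P) *\<^sub>R a) = complex_gaussian_density (\<sigma>\<^sup>2) n * exp (- 2 * llr P \<sigma> a n)"
proof -
  have "(cmod (n + (2 * r) *\<^sub>R a))\<^sup>2 = (cmod n)\<^sup>2 + 2 * (2 * r\<^sup>2 * (cmod a)\<^sup>2 + 2 * r * (a \<bullet> n))" for r
    unfolding cmod_power2 by (simp add: inner_complex_def power2_eq_square algebra_simps)
  from this[of "sqrt P"]
  have "(cmod (n + (2 * sqrt P) *\<^sub>R a))\<^sup>2 = (cmod n)\<^sup>2 + 2 * (2 * P * (cmod a)\<^sup>2 + 2 * sqrt P * (a \<bullet> n))"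
    using pos by simp
  then have "- (cmod (n + (2 * sqrt P) *\<^sub>R a))\<^sup>2 / \<sigma>\<^sup>2 = - (cmod n)\<^sup>2 / \<sigma>\<^sup>2 + - 2 * llr P \<sigma> a n"
    by (simp add: llr_def add_divide_distrib diff_divide_distrib)
  then show ?thesis unfolding complex_gaussian_density_def by (simp only: exp_add times_divide_eq_left)
qed

lemma output_density_at:
  "output_density P \<sigma> p a (a * bpsk_input P True + n)
    = complex_gaussian_density (\<sigma>\<^sup>2) n * (p + (1 - p) * exp (- 2 * llr P \<sigma> a n))"
  "output_density P \<sigma> p a (a * bpsk_input P False + n)
    = complex_gaussian_density (\<sigma>\<^sup>2) n * ((1 - p) + p * exp (- 2 * llr P \<sigma> (- a) n))"
proof -
  have 1: "a * bpsk_input P True + n - a * bpsk_input P True = n"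
    "a * bpsk_input P True + n - a * bpsk_input P False = n + (2 * sqrt P) *\<^sub>R a"
    "a * bpsk_input P False + n - a * bpsk_input P False = n"
    "a * bpsk_input P False + n - a * bpsk_input P True = n + (2 * sqrt P) *\<^sub>R (- a)"
    by (simp_all add: bpsk_input_def scaleR_conv_of_real)
  show "output_density P \<sigma> p a (a * bpsk_input P True + n)
    = complex_gaussian_density (\<sigma>\<^sup>2) n * (p + (1 - p) * exp (- 2 * llr P \<sigma> a n))"
    "output_density P \<sigma> p a (a * bpsk_input P False + n)
    = complex_gaussian_density (\<sigma>\<^sup>2) n * ((1 - p) + p * exp (- 2 * llr P \<sigma> (- a) n))"
    unfolding output_density_def 1 complex_gaussian_density_shift by (simp_all add: algebra_simps)
qed

lemma comm_rate_eq_info_transform: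
  "comm_rate P \<Omega> \<sigma> p = info_transform (sqrt (1 + 2 / (2 * P * \<Omega> / \<sigma>\<^sup>2))) p / ln 2"
proof -
  let ?s = "sqrt (1 + 2 / (2 * P * \<Omega> / \<sigma>\<^sup>2))"
  have s: "1 < ?s" using pos by simp
  have q: "1 - p \<in> {0..1}" using p by auto
  have nn: "0 < complex_gaussian_density (\<sigma>\<^sup>2) z" for z using pos by (simp add: complex_gaussian_density_pos)
  define g where "g \<omega> = log 2 (complex_gaussian_density (\<sigma>\<^sup>2)
      (channel_output P \<omega> - channel_coeff \<omega> * channel_input P \<omega>)
      / output_density P \<sigma> p (channel_coeff \<omega>) (channel_output P \<omega>))" for \<omega>
  have [measurable]: "g \<in> borel_measurable (channel_space \<Omega> \<sigma> p)" unfolding g_def by measurable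
  have "g (True, a, n) = - mixture_loss p (llr P \<sigma> a n)" for a n
    using nn[of n] mixture_pos[OF p, of "- 2 * llr P \<sigma> a n"]
    by (simp add: g_def channel_output_def channel_input_def channel_coeff_def output_density_at
        mixture_loss_def log_divide log_mult)
  moreover have "g (False, a, n) = - mixture_loss (1 - p) (llr P \<sigma> (- a) n)" for a n
    using nn[of n] mixture_pos[OF q, of "- 2 * llr P \<sigma> (- a) n"]
    by (simp add: g_def channel_output_def channel_input_def channel_coeff_def output_density_at
        mixture_loss_def log_divide log_mult)
  ultimately have g: "(\<lambda>an. g (True, an)) = (\<lambda>(a, n). - mixture_loss p (llr P \<sigma> a n))"
    "(\<lambda>an. g (False, an)) = (\<lambda>(a, n). - mixture_loss (1 - p) (llr P \<sigma> (- a) n))" by auto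
  note t = llr_transfer[OF p] llr_transfer[OF q]
  note r = reflect_coeff[OF t(3)]
  have i: "integrable (coeff_noise \<Omega> \<sigma>) (\<lambda>an. g (b, an))" for b
    using integrable_minus[OF t(1)] integrable_minus[OF r(1)] by (cases b) (simp_all add: g split_beta')
  have "comm_rate P \<Omega> \<sigma> p = p * (\<integral>an. g (True, an) \<partial>coeff_noise \<Omega> \<sigma>) + (1 - p) * (\<integral>an. g (False, an) \<partial>coeff_noise \<Omega> \<sigma>)"
    unfolding comm_rate_eq_expectation g_def[symmetric]
    by (rule integral_channel_space) (use pos p i in auto)
  also have "\<dots> = - (p * (LINT t|lborel. llr_density ?s t * mixture_loss p t)
    + (1 - p) * (LINT t|lborel. llr_density ?s t * mixture_loss (1 - p) t))"
    using r(2) t(2,4) unfolding g by (simp add: split_beta')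
  finally show ?thesis using expected_mixture_loss[OF s p] by simp
qed

text \<open>The logarithm of a ratio of Gaussian densities is a quadratic polynomial in the moduli,
  so finite second moments of coefficient and noise suffice.\<close>

lemma integrable_output_gain:
  "integrable (coeff_noise \<Omega> \<sigma>) (\<lambda>(a, n). output_gain P \<Omega> \<sigma> a n)"
proof -
  let ?v = "P * \<Omega> + \<sigma>\<^sup>2"
  have v: "0 < ?v" using pos by (simp add: add_pos_pos)
  have a: "integrable (coeff_noise \<Omega> \<sigma>) (\<lambda>(a, n). (cmod a)\<^sup>2)"
    using integrable_complex_gaussian_cmod_power2[OF pos(2)]
    by (subst (asm) N.distr_pair_fst[symmetric], subst (asm) integrable_distr_eq) (auto simp: split_beta')
  have n: "integrable (coeff_noise \<Omega> \<sigma>) (\<lambda>(a, n). (cmod n)\<^sup>2)"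
  proof (rule AN.Fubini_integrable)
    show "integrable (complex_gaussian \<Omega>) (\<lambda>x. \<integral>y. norm (case (x, y) of (a, n) \<Rightarrow> (cmod n)\<^sup>2) \<partial>complex_gaussian (\<sigma>\<^sup>2))"
      by simp
    show "AE x in complex_gaussian \<Omega>. integrable (complex_gaussian (\<sigma>\<^sup>2)) (\<lambda>y. case (x, y) of (a, n) \<Rightarrow> (cmod n)\<^sup>2)"
      using integrable_complex_gaussian_cmod_power2[of "\<sigma>\<^sup>2"] pos by simp
  qed auto
  have y: "integrable (coeff_noise \<Omega> \<sigma>) (\<lambda>(a, n). (cmod (a * bpsk_input P True + n))\<^sup>2)"
  proof (rule Bochner_Integration.integrable_bound)
    show "integrable (coeff_noise \<Omega> \<sigma>) (\<lambda>x. 2 * P * (case x of (a, n) \<Rightarrow> (cmod a)\<^sup>2) + 2 * (case x of (a, n) \<Rightarrow> (cmod n)\<^sup>2))"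
      using a n by (intro Bochner_Integration.integrable_add integrable_mult_right)
    have "(cmod (a * bpsk_input P True + n))\<^sup>2 \<le> 2 * P * (cmod a)\<^sup>2 + 2 * (cmod n)\<^sup>2" for a n
    proof -
      have "(cmod (a * bpsk_input P True + n))\<^sup>2 \<le> (sqrt P * cmod a + cmod n)\<^sup>2"
        using norm_triangle_ineq[of "a * bpsk_input P True" n] pos
        by (intro power_mono) (auto simp: bpsk_input_def norm_mult mult.commute)
      also have "\<dots> \<le> 2 * (sqrt P * cmod a)\<^sup>2 + 2 * (cmod n)\<^sup>2"
        using zero_le_power2[of "sqrt P * cmod a - cmod n"] by (simp add: power2_eq_square algebra_simps)
      finally show ?thesis using pos by (simp add: power_mult_distrib)
    qed
    then show "AE x in (coeff_noise \<Omega> \<sigma>). norm (case x of (a, n) \<Rightarrow> (cmod (a * bpsk_input P True + n))\<^sup>2)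
      \<le> norm (2 * P * (case x of (a, n) \<Rightarrow> (cmod a)\<^sup>2) + 2 * (case x of (a, n) \<Rightarrow> (cmod n)\<^sup>2))"
      using pos by (intro AE_I2) (auto simp: abs_of_nonneg)
  qed auto
  have "output_gain P \<Omega> \<sigma> a n = (ln (?v / \<sigma>\<^sup>2) - (cmod n)\<^sup>2 / \<sigma>\<^sup>2 + (cmod (a * bpsk_input P True + n))\<^sup>2 / ?v) / ln 2" for a n
    using pos v by (simp add: output_gain_def complex_gaussian_density_def log_def ln_div ln_mult)
  then have "(\<lambda>(a, n). output_gain P \<Omega> \<sigma> a n) = (\<lambda>x. (ln (?v / \<sigma>\<^sup>2) - (case x of (a, n) \<Rightarrow> (cmod n)\<^sup>2) / \<sigma>\<^sup>2
    + (case x of (a, n) \<Rightarrow> (cmod (a * bpsk_input P True + n))\<^sup>2) / ?v) / ln 2)" by auto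
  then show ?thesis using n y by simp
qed

text \<open>The information density splits into \<open>mixture_loss\<close>, which carries all
  dependence on \<open>p\<close>, and \<open>output_gain\<close>. The mean of the latter is left
  unevaluated: it only translates the boundary along the D axis.\<close>

lemma sensing_rate_eq_info_transform:
  "sensing_rate P \<Omega> \<sigma> p = (\<integral>(a, n). output_gain P \<Omega> \<sigma> a n \<partial>coeff_noise \<Omega> \<sigma>)
    - info_transform (sqrt (1 + 2 / (2 * P * \<Omega> / \<sigma>\<^sup>2))) p / ln 2"
proof -
  let ?s = "sqrt (1 + 2 / (2 * P * \<Omega> / \<sigma>\<^sup>2))"
  have s: "1 < ?s" using pos by simp
  have q: "1 - p \<in> {0..1}" using p by auto
  have v: "0 < P * \<Omega> + \<sigma>\<^sup>2" using pos by (simp add: add_pos_pos)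
  have nn: "0 < complex_gaussian_density (\<sigma>\<^sup>2) z" "0 < complex_gaussian_density (P * \<Omega> + \<sigma>\<^sup>2) z" for z
    using pos v by (simp_all add: complex_gaussian_density_pos)
  note nz = nn[THEN less_imp_neq, THEN not_sym]
  define g where "g \<omega> = log 2 (output_density P \<sigma> p (channel_coeff \<omega>) (channel_output P \<omega>)
      / complex_gaussian_density (P * \<Omega> + \<sigma>\<^sup>2) (channel_output P \<omega>))" for \<omega>
  have [measurable]: "g \<in> borel_measurable (channel_space \<Omega> \<sigma> p)" unfolding g_def by measurable
  have "g (True, a, n) = mixture_loss p (llr P \<sigma> a n) + output_gain P \<Omega> \<sigma> a n" for a n
    using nn mixture_pos[OF p, of "- 2 * llr P \<sigma> a n"]
    by (simp add: g_def channel_output_def channel_coeff_def output_density_at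
        mixture_loss_def output_gain_def log_divide log_mult nz)
  moreover have "g (False, a, n) = mixture_loss (1 - p) (llr P \<sigma> (- a) n) + output_gain P \<Omega> \<sigma> (- a) n" for a n
  proof -
    have "- a * bpsk_input P True = a * bpsk_input P False" by (simp add: bpsk_input_def)
    then show ?thesis
      using nn mixture_pos[OF q, of "- 2 * llr P \<sigma> (- a) n"]
      by (simp add: g_def channel_output_def channel_coeff_def output_density_at
        mixture_loss_def output_gain_def log_divide log_mult nz)
  qed
  ultimately have g: "(\<lambda>an. g (True, an)) = (\<lambda>x. (case x of (a, n) \<Rightarrow> mixture_loss p (llr P \<sigma> a n)) + (case x of (a, n) \<Rightarrow> output_gain P \<Omega> \<sigma> a n))"
    "(\<lambda>an. g (False, an)) = (\<lambda>x. (case x of (a, n) \<Rightarrow> mixture_loss (1 - p) (llr P \<sigma> (- a) n)) + (case x of (a, n) \<Rightarrow> output_gain P \<Omega> \<sigma> (- a) n))" by auto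
  note t = llr_transfer[OF p] llr_transfer[OF q]
  note r = reflect_coeff[OF t(3)]
  note o = integrable_output_gain reflect_coeff[OF integrable_output_gain]
  have i: "integrable (coeff_noise \<Omega> \<sigma>) (\<lambda>an. g (b, an))" for b
    using t(1) r(1) o(1,2) by (cases b) (simp_all only: g Bochner_Integration.integrable_add)
  have "sensing_rate P \<Omega> \<sigma> p = p * (\<integral>an. g (True, an) \<partial>coeff_noise \<Omega> \<sigma>) + (1 - p) * (\<integral>an. g (False, an) \<partial>coeff_noise \<Omega> \<sigma>)"
    unfolding sensing_rate_eq_expectation g_def[symmetric]
    by (rule integral_channel_space) (use pos p i in auto)
  also have "\<dots> = (p * (LINT t|lborel. llr_density ?s t * mixture_loss p t)
    + (1 - p) * (LINT t|lborel. llr_density ?s t * mixture_loss (1 - p) t))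
    + (\<integral>(a, n). output_gain P \<Omega> \<sigma> a n \<partial>coeff_noise \<Omega> \<sigma>)"
    unfolding g Bochner_Integration.integral_add[OF t(1) o(1)] Bochner_Integration.integral_add[OF r(1) o(2)]
      r(2) t(2,4) o(3) by (simp add: algebra_simps)
  finally show ?thesis using expected_mixture_loss[OF s p] by simp
qed

end

section \<open>The single-mode boundary\<close>

theorem theorem2:
  fixes P \<Omega>\<^sub>H \<Omega>\<^sub>S \<sigma>\<^sub>1 \<sigma>\<^sub>2 \<gamma>\<^sub>c \<gamma>\<^sub>s D_min D_max :: real
    and R G C\<^sub>0 :: "real \<Rightarrow> real"
  assumes "P > 0" "\<Omega>\<^sub>H > 0" "\<Omega>\<^sub>S > 0" "\<sigma>\<^sub>1 > 0" "\<sigma>\<^sub>2 > 0"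
  defines "\<gamma>\<^sub>c \<equiv> 2 * P * \<Omega>\<^sub>H / \<sigma>\<^sub>1\<^sup>2"
    and "\<gamma>\<^sub>s \<equiv> 2 * P * \<Omega>\<^sub>S / \<sigma>\<^sub>2\<^sup>2"
    and "R \<equiv> comm_rate P \<Omega>\<^sub>H \<sigma>\<^sub>1"
    and "G \<equiv> sensing_rate P \<Omega>\<^sub>S \<sigma>\<^sub>2"
    and "D_min \<equiv> G (1/2)"
    and "D_max \<equiv> G 1"
    and "C\<^sub>0 \<equiv> single_mode_boundary R G"
  shows "(\<gamma>\<^sub>c > \<gamma>\<^sub>s \<longrightarrow>
            strictly_concave_on {D_min<..<D_max} C\<^sub>0 \<and> time_sharing_unnecessary D_min D_max C\<^sub>0) \<and>
         (\<gamma>\<^sub>c < \<gamma>\<^sub>s \<longrightarrow>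
            strictly_convex_on {D_min<..<D_max} C\<^sub>0 \<and> time_sharing_strict_gain D_min D_max C\<^sub>0) \<and>
         (\<gamma>\<^sub>c = \<gamma>\<^sub>s \<longrightarrow>
            (\<exists>a b. \<forall>D\<in>{D_min..D_max}. C\<^sub>0 D = a * D + b))"
proof -
  define s\<^sub>c s\<^sub>s where "s\<^sub>c = sqrt (1 + 2 / \<gamma>\<^sub>c)" and "s\<^sub>s = sqrt (1 + 2 / \<gamma>\<^sub>s)"
  define K where "K = (\<integral>(a, n). output_gain P \<Omega>\<^sub>S \<sigma>\<^sub>2 a n \<partial>(complex_gaussian \<Omega>\<^sub>S \<Otimes>\<^sub>M complex_gaussian (\<sigma>\<^sub>2\<^sup>2)))"
  define F\<^sub>c F\<^sub>s where "F\<^sub>c p = info_transform s\<^sub>c p / ln 2" and "F\<^sub>s p = info_transform s\<^sub>s p / ln 2" for p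
  have R: "R p = F\<^sub>c p" and G: "G p = K - F\<^sub>s p" if "p \<in> {1/2..1}" for p
    using comm_rate_eq_info_transform[of P \<Omega>\<^sub>H \<sigma>\<^sub>1 p] sensing_rate_eq_info_transform[of P \<Omega>\<^sub>S \<sigma>\<^sub>2 p] assms(1-5) that
    by (simp_all add: R_def G_def F\<^sub>c_def F\<^sub>s_def K_def s\<^sub>c_def s\<^sub>s_def \<gamma>\<^sub>c_def \<gamma>\<^sub>s_def)
  have \<gamma>: "0 < \<gamma>\<^sub>c" "0 < \<gamma>\<^sub>s" using assms(1-5) by (simp_all add: \<gamma>\<^sub>c_def \<gamma>\<^sub>s_def)
  then have s: "1 < s\<^sub>c" "1 < s\<^sub>s" by (simp_all add: s\<^sub>c_def s\<^sub>s_def)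
  \<comment> \<open>The order reverses because s = sqrt (1 + 2 / \<gamma>) decreases in
    \<gamma>.\<close>
  have s_less: "s\<^sub>c < s\<^sub>s \<longleftrightarrow> \<gamma>\<^sub>s < \<gamma>\<^sub>c" "s\<^sub>s < s\<^sub>c \<longleftrightarrow> \<gamma>\<^sub>c < \<gamma>\<^sub>s"
    using \<gamma> by (auto simp: s\<^sub>c_def s\<^sub>s_def field_simps)
  have "continuous_on {1/2..1} (\<lambda>p. K - F\<^sub>s p)"
    unfolding F\<^sub>s_def
    by (intro continuous_intros continuous_on_subset[OF continuous_on_info_transform[OF s(2)]]) auto
  then have cont: "continuous_on {1/2..1} G" by (rule continuous_on_eq) (simp add: G)
  have mono: "strict_mono_on {1/2..1} G"
  proof (rule strict_mono_onI)
    fix p q :: real assume "p \<in> {1/2..1}" "q \<in> {1/2..1}" "p < q"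
    then show "G p < G q"
      using info_transform_strict_antimono[OF s(2), of p q] by (simp add: G F\<^sub>s_def divide_strict_right_mono)
  qed
  have lt: "D_min < D_max"
    using strict_mono_onD[OF mono, of "1/2" 1] by (simp add: D_min_def D_max_def)
  have rel: "(info_transform s\<^sub>1 p / ln 2 - info_transform s\<^sub>1 q / ln 2) * (info_transform s\<^sub>2 q / ln 2 - info_transform s\<^sub>2 r / ln 2)
      < (info_transform s\<^sub>1 q / ln 2 - info_transform s\<^sub>1 r / ln 2) * (info_transform s\<^sub>2 p / ln 2 - info_transform s\<^sub>2 q / ln 2)"
    if "1 < s\<^sub>1" "s\<^sub>1 < s\<^sub>2" "1/2 \<le> p" "p < q" "q < r" "r \<le> 1" for s\<^sub>1 s\<^sub>2 p q r
    using info_transform_relative_mono[OF that]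
    by (simp add: diff_divide_distrib[symmetric] divide_strict_right_mono)
  \<comment> \<open>Proved on the closed interval: the envelope includes the end points, and the
    claim on the open interval follows by restriction.\<close>
  have concave: "strictly_concave_on {D_min..D_max} C\<^sub>0" if "\<gamma>\<^sub>c > \<gamma>\<^sub>s"
  proof -
    have "strictly_convex_on {G (1/2)..G 1} (single_mode_boundary (\<lambda>p. - R p) G)"
    proof (rule single_mode_boundary_slopes[OF cont mono])
      fix p q r :: real assume p: "1/2 \<le> p" "p < q" "q < r" "r \<le> 1"
      then show "(- R q - - R p) * (G r - G q) < (- R r - - R q) * (G q - G p)"
        using rel[OF s(1) _ p, of s\<^sub>s] that by (simp add: s_less R G F\<^sub>c_def F\<^sub>s_def)
    qed
    moreover have "single_mode_boundary (\<lambda>p. - R p) G = (\<lambda>D. - single_mode_boundary R G D)"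
      by (simp add: fun_eq_iff single_mode_boundary_def)
    ultimately show ?thesis
      by (simp add: strictly_concave_on_def C\<^sub>0_def D_min_def D_max_def)
  qed
  have convex: "strictly_convex_on {D_min..D_max} C\<^sub>0" if "\<gamma>\<^sub>c < \<gamma>\<^sub>s"
    unfolding C\<^sub>0_def D_min_def D_max_def
  proof (rule single_mode_boundary_slopes[OF cont mono])
    fix p q r :: real assume p: "1/2 \<le> p" "p < q" "q < r" "r \<le> 1"
    then show "(R q - R p) * (G r - G q) < (R r - R q) * (G q - G p)"
      using rel[OF s(2) _ p, of s\<^sub>c] that by (simp add: s_less R G F\<^sub>c_def F\<^sub>s_def algebra_simps)
  qed
  \<comment> \<open>With equal SNRs the two transforms coincide, so R + G is constantly
    \<open>K\<close> along the curve.\<close>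
  have affine: "C\<^sub>0 D = - 1 * D + K" if eq: "\<gamma>\<^sub>c = \<gamma>\<^sub>s" and D: "D \<in> {D_min..D_max}" for D
  proof -
    obtain p where "p \<in> {1/2..1}" "D = G p"
      using range_on_unit_half[OF cont] D unfolding D_min_def D_max_def by metis
    then show ?thesis
      using single_mode_boundary_at[OF strict_mono_on_imp_inj_on[OF mono], of p R] eq
      by (simp add: C\<^sub>0_def R G F\<^sub>c_def F\<^sub>s_def s\<^sub>c_def s\<^sub>s_def)
  qed
  have sub: "{D_min<..<D_max} \<subseteq> {D_min..D_max}" "convex {D_min<..<D_max}" by auto
  show ?thesis
  proof (intro conjI impI)
    show "strictly_concave_on {D_min<..<D_max} C\<^sub>0" if "\<gamma>\<^sub>c > \<gamma>\<^sub>s"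
      using strictly_convex_on_subset[OF _ sub] concave[OF that] unfolding strictly_concave_on_def by blast
    show "time_sharing_unnecessary D_min D_max C\<^sub>0" if "\<gamma>\<^sub>c > \<gamma>\<^sub>s"
      using strictly_convex_on_imp_convex_on concave[OF that] unfolding strictly_concave_on_def
      by (intro concave_imp_time_sharing_unnecessary) (simp add: concave_on_def)
    show "strictly_convex_on {D_min<..<D_max} C\<^sub>0" if "\<gamma>\<^sub>c < \<gamma>\<^sub>s"
      by (rule strictly_convex_on_subset[OF convex[OF that] sub])
    show "time_sharing_strict_gain D_min D_max C\<^sub>0" if "\<gamma>\<^sub>c < \<gamma>\<^sub>s"
      by (rule strictly_convex_imp_time_sharing_strict_gain[OF lt convex[OF that]])
    show "\<exists>a b. \<forall>D\<in>{D_min..D_max}. C\<^sub>0 D = a * D + b" if "\<gamma>\<^sub>c = \<gamma>\<^sub>s"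
      using affine[OF that] by blast
  qed
qed

end
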